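(* Let $T=\sum_{\lambda\in\Lambda}c_\lambda U_\lambda$ with $\Lambda\subset\mathbb{R}^{2d}$ finite, $|\Lambda|=N$, and let $R_0=\max_{\lambda\in\Lambda}\|\lambda\|$. Assume $T$ is invertible in $B(L^2(\mathbb{R}^d))$. Put $A=\|T^{-1}\|_{B(L^2(\mathbb{R}^d))}^{-2}$, $B=\|T\|^2_{B(L^2(\mathbb{R}^d))}$ and $\rho=\max(1,2R_0)$. Let $v$ be a submultiplicative weight on $\mathbb{R}^{2d}$ whose radial function is polynomial: $w(r)=C(1+r)^m$ for all $r\ge0$, for some $C>0$ and $m\in\mathbb{N}$. Then $T^{-1}\in\mathcal{A}_v$ and $$\|T^{-1}\|_{\mathcal{A}_v}\le\frac{C\rho^m\|T\|_{\mathcal{A}_v}}{A}\,(m+N)!\left(\frac{A+B}{2A}\right)^{m+N}.$$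
   Context: For $\lambda=(t,\omega)\in\mathbb{R}^d\times\mathbb{R}^d$, $U_{(t,\omega)}f(x)=e^{i\langle\omega,x\rangle}f(x-t)$ on $L^2(\mathbb{R}^d)$; $\|\cdot\|$ is the Euclidean norm on $\mathbb{R}^{2d}$. A weight is a function $v:\mathbb{R}^{2d}\to[0,\infty)$ with $v(0)=1$, $v(-x)=v(x)$, radially non-decreasing; it is submultiplicative if $v(x+y)\le v(x)v(y)$; its radial function is $w(r)=\max_{\|x\|=r}v(x)$. $\mathcal{A}_v$ is the Banach algebra of operators $T=\sum_{\lambda\in\mathbb{R}^{2d}}c_\lambda U_\lambda$ with $\|T\|_{\mathcal{A}_v}:=\sum_\lambda v(\lambda)|c_\lambda|<\infty$. *)

theory Defs
  imports "HOL-Analysis.Analysis"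
begin

text \<open>R^d is modelled by an arbitrary Euclidean space 'a; the phase space R^{2d}
  is 'a \<times> 'a, whose product norm is the Euclidean norm sqrt(|t|^2+|w|^2).
  Elements of L^2(R^d) are represented by square-integrable functions
  'a \<Rightarrow> complex (equality in L^2 = equality almost everywhere).\<close>

definition L2 :: "('a::euclidean_space \<Rightarrow> complex) set" where
  "L2 = {f. f \<in> borel_measurable lebesgue \<and> integrable lebesgue (\<lambda>x. (cmod (f x))^2)}"

definition l2norm :: "('a::euclidean_space \<Rightarrow> complex) \<Rightarrow> real" where
  "l2norm f = sqrt (integral\<^sup>L lebesgue (\<lambda>x. (cmod (f x))^2))"

definition opnorm2 :: "(('a::euclidean_space \<Rightarrow> complex) \<Rightarrow> ('a \<Rightarrow> complex)) \<Rightarrow> real" where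
  "opnorm2 S = Sup {l2norm (S f) | f. f \<in> L2 \<and> l2norm f \<le> 1}"

definition tfshift :: "'a::euclidean_space \<times> 'a \<Rightarrow> ('a \<Rightarrow> complex) \<Rightarrow> 'a \<Rightarrow> complex" where
  "tfshift lam f x = cis (snd lam \<bullet> x) * f (x - fst lam)"

definition tfsum :: "('a::euclidean_space \<times> 'a) set \<Rightarrow> ('a \<times> 'a \<Rightarrow> complex) \<Rightarrow> ('a \<Rightarrow> complex) \<Rightarrow> 'a \<Rightarrow> complex" where
  "tfsum Lam c f x = (\<Sum>lam\<in>Lam. c lam * tfshift lam f x)"

definition bounded_op_L2 :: "(('a::euclidean_space \<Rightarrow> complex) \<Rightarrow> ('a \<Rightarrow> complex)) \<Rightarrow> bool" where
  "bounded_op_L2 S \<longleftrightarrow>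
     (\<forall>f\<in>L2. S f \<in> L2) \<and>
     (\<forall>f\<in>L2. \<forall>g\<in>L2. AE x in lebesgue. S (\<lambda>y. f y + g y) x = S f x + S g x) \<and>
     (\<forall>f\<in>L2. \<forall>a::complex. AE x in lebesgue. S (\<lambda>y. a * f y) x = a * S f x) \<and>
     (\<exists>K. \<forall>f\<in>L2. l2norm (S f) \<le> K * l2norm f)"

definition inverse_op_L2 :: "(('a::euclidean_space \<Rightarrow> complex) \<Rightarrow> ('a \<Rightarrow> complex)) \<Rightarrow> (('a \<Rightarrow> complex) \<Rightarrow> ('a \<Rightarrow> complex)) \<Rightarrow> bool" where
  "inverse_op_L2 S T \<longleftrightarrow> bounded_op_L2 S \<and>
     (\<forall>f\<in>L2. AE x in lebesgue. S (T f) x = f x) \<and>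
     (\<forall>f\<in>L2. AE x in lebesgue. T (S f) x = f x)"

definition weight :: "('a::euclidean_space \<times> 'a \<Rightarrow> real) \<Rightarrow> bool" where
  "weight v \<longleftrightarrow> (\<forall>x. v x \<ge> 0) \<and> v 0 = 1 \<and> (\<forall>x. v (- x) = v x) \<and>
     (\<forall>x s t. 0 \<le> s \<longrightarrow> s \<le> t \<longrightarrow> v (s *\<^sub>R x) \<le> v (t *\<^sub>R x))"

definition submultiplicative :: "('a::euclidean_space \<times> 'a \<Rightarrow> real) \<Rightarrow> bool" where
  "submultiplicative v \<longleftrightarrow> (\<forall>x y. v (x + y) \<le> v x * v y)"

text \<open>"w(r) = y", where w(r) = max over the sphere of radius r of v.\<close>
definition radial_max :: "('a::euclidean_space \<times> 'a \<Rightarrow> real) \<Rightarrow> real \<Rightarrow> real \<Rightarrow> bool" where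
  "radial_max v r y \<longleftrightarrow> (\<exists>x. norm x = r \<and> v x = y) \<and> (\<forall>x. norm x = r \<longrightarrow> v x \<le> y)"

text \<open>Membership of an operator S in A_v with coefficient function d: the series
  sum_lam d_lam U_lam (countable support, absolutely v-summable) represents S on L^2.\<close>
definition Av_repr :: "('a::euclidean_space \<times> 'a \<Rightarrow> real) \<Rightarrow> ('a \<times> 'a \<Rightarrow> complex) \<Rightarrow> (('a \<Rightarrow> complex) \<Rightarrow> ('a \<Rightarrow> complex)) \<Rightarrow> bool" where
  "Av_repr v d S \<longleftrightarrow> (\<lambda>lam. v lam * cmod (d lam)) summable_on UNIV \<and>
     (\<forall>f\<in>L2. AE x in lebesgue. (\<lambda>lam. d lam * tfshift lam f x) summable_on UNIV \<and>
         S f x = (\<Sum>\<^sub>\<infinity>lam. d lam * tfshift lam f x))"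

definition Av_norm :: "('a::euclidean_space \<times> 'a \<Rightarrow> real) \<Rightarrow> ('a \<times> 'a \<Rightarrow> complex) \<Rightarrow> real" where
  "Av_norm v d = (\<Sum>\<^sub>\<infinity>lam. v lam * cmod (d lam))"

end

theory Submission
  imports Defs
begin

text \<open>
  Write \<open>A\<close> and \<open>B\<close> for the optimal bounds of the positive operator \<open>T\<^sup>* T\<close> and
  \<open>H = I - 2 / (A + B) T\<^sup>* T\<close>, a self-adjoint operator of norm at most
  \<open>q = (B - A) / (B + A) < 1\<close>, so that \<open>T\<^sup>-\<^sup>1 = 2 / (A + B) (\<Sum>n. H\<^sup>n) T\<^sup>*\<close>. The power
  \<open>H\<^sup>n\<close> is a sum of time-frequency shifts by differences of two \<open>n\<close>-fold sums of elements
  of \<open>\<Lambda>\<close>; there are at most \<open>(n+N-1 choose n)\<^sup>2\<close> of them, all of norm at most \<open>2 n R\<^sub>0\<close>.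
  The square sum of the coefficients of a finite sum of shifts is at most its squared operator
  norm, so Cauchy-Schwarz bounds the weighted coefficient sum of \<open>H\<^sup>n\<close> by
  \<open>C (1 + 2 n R\<^sub>0)\<^sup>m (n+N-1 choose n) q\<^sup>n\<close>. Summing over \<open>n\<close> gives a negative binomial series
  with value a multiple of \<open>(1 - q)\<close> to the power \<open>-(m+N)\<close>, where \<open>1 - q = 2 A / (A + B)\<close>.
\<close>

section \<open>Square-integrable functions\<close>

lemma lebesgue_distr_translation: "distr lebesgue lebesgue (\<lambda>x. x + t) = (lebesgue :: 'a::euclidean_space measure)"
  and measurable_lebesgue_translation: "(\<lambda>x. x + t) \<in> lebesgue \<rightarrow>\<^sub>M (lebesgue :: 'a measure)"
proof -
  \<comment> \<open>A translation is the coordinatewise affine map with all scaling factors 1, whose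
    change-of-variables density is 1.\<close>
  have eq: "(\<lambda>x::'a. t + (\<Sum>j\<in>Basis. (1 * (x \<bullet> j)) *\<^sub>R j)) = (\<lambda>x. x + t)"
    by (simp add: euclidean_representation add.commute)
  show "(\<lambda>x. x + t) \<in> lebesgue \<rightarrow>\<^sub>M (lebesgue :: 'a measure)"
    using lebesgue_affine_measurable[of "\<lambda>_. 1" t] unfolding eq by simp
  show "distr lebesgue lebesgue (\<lambda>x. x + t) = (lebesgue :: 'a measure)"
    using lebesgue_affine_euclidean[of "\<lambda>_. 1" t] unfolding eq by (simp add: density_1)
qed

lemma
  fixes f :: "'a::euclidean_space \<Rightarrow> 'b::{banach, second_countable_topology}"
  assumes "f \<in> borel_measurable lebesgue"
  shows borel_measurable_lebesgue_translate: "(\<lambda>x. f (x + t)) \<in> borel_measurable lebesgue"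
    and integrable_lebesgue_translate: "integrable lebesgue (\<lambda>x. f (x + t)) \<longleftrightarrow> integrable lebesgue f"
    and integral_lebesgue_translate: "(LINT x|lebesgue. f (x + t)) = (LINT x|lebesgue. f x)"
proof -
  show "(\<lambda>x. f (x + t)) \<in> borel_measurable lebesgue"
    using measurable_compose[OF measurable_lebesgue_translation assms] .
  show "integrable lebesgue (\<lambda>x. f (x + t)) \<longleftrightarrow> integrable lebesgue f"
    using integrable_distr_eq[OF measurable_lebesgue_translation, of f t] assms
    by (simp add: lebesgue_distr_translation)
  show "(LINT x|lebesgue. f (x + t)) = (LINT x|lebesgue. f x)"
    using integral_distr[OF measurable_lebesgue_translation, of f t] assms
    by (simp add: lebesgue_distr_translation)
qed

lemma AE_lebesgue_translate:
  fixes P :: "'a::euclidean_space \<Rightarrow> bool"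
  assumes "AE x in lebesgue. P x"
  shows "AE x in lebesgue. P (x + t)"
  using AE_distrD[OF measurable_lebesgue_translation, of P t] assms
  unfolding lebesgue_distr_translation by blast

lemma L2_measurable: "f \<in> L2 \<Longrightarrow> f \<in> borel_measurable lebesgue"
  by (simp add: L2_def)

lemma L2_integrable: "f \<in> L2 \<Longrightarrow> integrable lebesgue (\<lambda>x. (cmod (f x))\<^sup>2)"
  by (simp add: L2_def)

lemma l2norm_nonneg: "0 \<le> l2norm f"
  by (simp add: l2norm_def)

lemma l2norm_sq: "(l2norm f)\<^sup>2 = (LINT x|lebesgue. (cmod (f x))\<^sup>2)"
  by (simp add: l2norm_def)

lemma l2norm_cong_AE:
  assumes "f \<in> borel_measurable lebesgue" "g \<in> borel_measurable lebesgue"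
    and "AE x in lebesgue. f x = g x"
  shows "l2norm f = l2norm g"
proof -
  have "(LINT x|lebesgue. (cmod (f x))\<^sup>2) = (LINT x|lebesgue. (cmod (g x))\<^sup>2)"
    using assms by (intro integral_cong_AE) auto
  then show ?thesis by (simp add: l2norm_def)
qed

lemma cmod_add_sq_le: "(cmod (a + b))\<^sup>2 \<le> 2 * (cmod a)\<^sup>2 + 2 * (cmod b)\<^sup>2"
proof -
  have "(cmod (a + b))\<^sup>2 \<le> (cmod a + cmod b)\<^sup>2"
    by (intro power_mono norm_triangle_ineq) auto
  also have "\<dots> \<le> 2 * (cmod a)\<^sup>2 + 2 * (cmod b)\<^sup>2"
    using zero_le_power2[of "cmod a - cmod b"] by (simp add: power2_eq_square algebra_simps)
  finally show ?thesis .
qed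

lemma L2_add:
  assumes "f \<in> L2" "g \<in> L2"
  shows "(\<lambda>x. f x + g x) \<in> L2"
proof -
  note [measurable] = assms[THEN L2_measurable]
  have "integrable lebesgue (\<lambda>x. (cmod (f x + g x))\<^sup>2)"
  proof (rule Bochner_Integration.integrable_bound)
    show "integrable lebesgue (\<lambda>x. 2 * (cmod (f x))\<^sup>2 + 2 * (cmod (g x))\<^sup>2)"
      using assms[THEN L2_integrable] by auto
  qed (auto simp: cmod_add_sq_le)
  then show ?thesis by (simp add: L2_def)
qed

lemma L2_cmult: "f \<in> L2 \<Longrightarrow> (\<lambda>x. a * f x) \<in> L2"
  by (auto simp: L2_def norm_mult power_mult_distrib)

lemma L2_zero: "(\<lambda>x. 0) \<in> L2"
  by (simp add: L2_def)

lemma l2norm_cmult: "l2norm (\<lambda>x. a * f x) = cmod a * l2norm f"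
  by (simp add: l2norm_def norm_mult power_mult_distrib real_sqrt_mult)

lemma L2_diff:
  assumes "f \<in> L2" "g \<in> L2"
  shows "(\<lambda>x. f x - g x) \<in> L2"
  using L2_add[OF assms(1) L2_cmult[OF assms(2), of "-1"]] by simp

lemma L2_sum:
  assumes "\<And>i. i \<in> I \<Longrightarrow> f i \<in> L2"
  shows "(\<lambda>x. \<Sum>i\<in>I. f i x) \<in> L2"
  using assms by (induction I rule: infinite_finite_induct) (auto simp: L2_zero intro!: L2_add)

text \<open>A normalised function is needed twice: as test function for the bound on coefficients,
  and to see that \<open>opnorm2 S\<close> is positive. The indicator of the unit cube
  serves.\<close>

lemma L2_nontrivial: "\<exists>f::'a::euclidean_space \<Rightarrow> complex. f \<in> L2 \<and> l2norm f = 1"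
proof -
  define f :: "'a \<Rightarrow> complex" where "f = indicator (cbox 0 One)"
  have eq: "(cmod (f x))\<^sup>2 = indicator (cbox 0 One) x" for x
    by (simp add: f_def indicator_def)
  have "integrable lebesgue (indicator (cbox 0 One :: 'a set) :: 'a \<Rightarrow> real)"
    by (simp add: integrable_indicator_iff emeasure_lborel_cbox_eq)
  moreover have "f \<in> borel_measurable lebesgue"
    unfolding f_def by (intro borel_measurable_indicator) simp
  ultimately have "f \<in> L2" by (simp add: L2_def eq)
  moreover have "(\<Prod>b\<in>Basis. (One::'a) \<bullet> b) = 1"
    by (intro prod.neutral) (auto simp: inner_sum_left_Basis)
  then have "l2norm f = 1"
    by (simp add: l2norm_def eq content_cbox_if box_eq_empty)
  ultimately show ?thesis by blast
qed

text \<open>This is the real part of the usual complex inner product. It determines the norm and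
  suffices for adjoints, since complex factors are moved across by
  \<open>inner_cmult_left\<close>.\<close>

definition L2_inner :: "('a::euclidean_space \<Rightarrow> complex) \<Rightarrow> ('a \<Rightarrow> complex) \<Rightarrow> real" where
  "L2_inner f g = (LINT x|lebesgue. f x \<bullet> g x)"

lemma L2_inner_integrable:
  assumes "f \<in> L2" "g \<in> L2"
  shows "integrable lebesgue (\<lambda>x. f x \<bullet> g x)"
proof (rule Bochner_Integration.integrable_bound)
  note [measurable] = assms[THEN L2_measurable]
  show "integrable lebesgue (\<lambda>x. (cmod (f x))\<^sup>2 + (cmod (g x))\<^sup>2)"
    using assms[THEN L2_integrable] by auto
  show "(\<lambda>x. f x \<bullet> g x) \<in> borel_measurable lebesgue" by measurable
  have "\<bar>a \<bullet> b\<bar> \<le> (cmod a)\<^sup>2 + (cmod b)\<^sup>2" for a b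
  proof -
    have "\<bar>a \<bullet> b\<bar> \<le> cmod a * cmod b" by (rule Cauchy_Schwarz_ineq2)
    also have "\<dots> \<le> 2 * (cmod a * cmod b)" by simp
    also have "\<dots> \<le> (cmod a)\<^sup>2 + (cmod b)\<^sup>2"
      using sum_squares_bound[of "cmod a" "cmod b"] by simp
    finally show ?thesis .
  qed
  then show "AE x in lebesgue. norm (f x \<bullet> g x) \<le> norm ((cmod (f x))\<^sup>2 + (cmod (g x))\<^sup>2)"
    by auto
qed

lemma L2_inner_self: "L2_inner f f = (l2norm f)\<^sup>2"
  by (simp add: L2_inner_def l2norm_sq power2_norm_eq_inner)

lemma L2_inner_commute: "L2_inner f g = L2_inner g f"
  by (simp add: L2_inner_def inner_commute)

lemma L2_inner_add_left:
  assumes "f \<in> L2" "g \<in> L2" "h \<in> L2"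
  shows "L2_inner (\<lambda>x. f x + g x) h = L2_inner f h + L2_inner g h"
  using assms by (simp add: L2_inner_def inner_add_left L2_inner_integrable)

lemma L2_inner_diff_left:
  assumes "f \<in> L2" "g \<in> L2" "h \<in> L2"
  shows "L2_inner (\<lambda>x. f x - g x) h = L2_inner f h - L2_inner g h"
  using assms by (simp add: L2_inner_def inner_diff_left L2_inner_integrable)

lemma L2_inner_add_right:
  assumes "f \<in> L2" "g \<in> L2" "h \<in> L2"
  shows "L2_inner h (\<lambda>x. f x + g x) = L2_inner h f + L2_inner h g"
  using assms by (simp add: L2_inner_def inner_add_right L2_inner_integrable)

lemma L2_inner_diff_right:
  assumes "f \<in> L2" "g \<in> L2" "h \<in> L2"
  shows "L2_inner h (\<lambda>x. f x - g x) = L2_inner h f - L2_inner h g"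
  using assms by (simp add: L2_inner_def inner_diff_right L2_inner_integrable)

lemma L2_inner_scale_left: "L2_inner (\<lambda>x. complex_of_real a * f x) h = a * L2_inner f h"
  by (simp add: L2_inner_def flip: scaleR_conv_of_real)

lemma L2_inner_scale_right: "L2_inner h (\<lambda>x. complex_of_real a * f x) = a * L2_inner h f"
  by (simp add: L2_inner_def flip: scaleR_conv_of_real)

lemma L2_inner_sum_left:
  assumes "\<And>i. i \<in> I \<Longrightarrow> f i \<in> L2" "h \<in> L2"
  shows "L2_inner (\<lambda>x. \<Sum>i\<in>I. f i x) h = (\<Sum>i\<in>I. L2_inner (f i) h)"
  using assms by (simp add: L2_inner_def inner_sum_left L2_inner_integrable)

lemma L2_inner_sum_right:
  assumes "\<And>i. i \<in> I \<Longrightarrow> f i \<in> L2" "h \<in> L2"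
  shows "L2_inner h (\<lambda>x. \<Sum>i\<in>I. f i x) = (\<Sum>i\<in>I. L2_inner h (f i))"
  using assms by (simp add: L2_inner_def inner_sum_right L2_inner_integrable)

lemma l2norm_add_sq:
  assumes "f \<in> L2" "g \<in> L2"
  shows "(l2norm (\<lambda>x. f x + g x))\<^sup>2 = (l2norm f)\<^sup>2 + 2 * L2_inner f g + (l2norm g)\<^sup>2"
  using assms L2_inner_commute[of g f]
  by (simp add: L2_inner_self[symmetric] L2_inner_add_left L2_inner_add_right L2_add)

lemma l2norm_diff_sq:
  assumes "f \<in> L2" "g \<in> L2"
  shows "(l2norm (\<lambda>x. f x - g x))\<^sup>2 = (l2norm f)\<^sup>2 - 2 * L2_inner f g + (l2norm g)\<^sup>2"
  using assms L2_inner_commute[of g f]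
  by (simp add: L2_inner_self[symmetric] L2_inner_diff_left L2_inner_diff_right L2_diff)

text \<open>For a symmetric operator the numerical radius dominates the norm: polarise the form
  at \<open>f\<close> and \<open>H f / s\<close>, with \<open>s = q\<close> unless \<open>q = 0\<close>.\<close>
lemma symmetric_L2_norm_le:
  assumes f: "f \<in> L2" and HL: "\<And>f. f \<in> L2 \<Longrightarrow> H f \<in> L2"
    and add: "\<And>f g. H (\<lambda>x. f x + g x) = (\<lambda>x. H f x + H g x)"
    and cm: "\<And>a f. H (\<lambda>x. a * f x) = (\<lambda>x. a * H f x)"
    and sym: "\<And>f g. f \<in> L2 \<Longrightarrow> g \<in> L2 \<Longrightarrow> L2_inner (H f) g = L2_inner f (H g)"
    and num: "\<And>f. f \<in> L2 \<Longrightarrow> \<bar>L2_inner (H f) f\<bar> \<le> q * (l2norm f)\<^sup>2"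
    and q: "0 \<le> q"
  shows "l2norm (H f) \<le> q * l2norm f"
proof -
  have H: "H f \<in> L2" using f HL by blast
  have polar: "4 * L2_inner (H f) g \<le> 2 * q * ((l2norm f)\<^sup>2 + (l2norm g)\<^sup>2)" if g: "g \<in> L2" for g
  proof -
    have dif: "H (\<lambda>x. f x - g x) = (\<lambda>x. H f x - H g x)"
      using add[of f "\<lambda>x. -1 * g x"] unfolding cm by simp
    note L = f g HL[OF f] HL[OF g]
    have "L2_inner (H (\<lambda>x. f x + g x)) (\<lambda>x. f x + g x)
       = L2_inner (H f) f + 2 * L2_inner (H f) g + L2_inner (H g) g"
      using L sym[OF g f] L2_inner_commute[of g "H f"] unfolding add
      by (simp add: L2_inner_add_left L2_inner_add_right L2_add)
    moreover have "L2_inner (H (\<lambda>x. f x - g x)) (\<lambda>x. f x - g x)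
       = L2_inner (H f) f - 2 * L2_inner (H f) g + L2_inner (H g) g"
      using L sym[OF g f] L2_inner_commute[of g "H f"] unfolding dif
      by (simp add: L2_inner_diff_left L2_inner_diff_right L2_diff)
    \<comment> \<open>The difference of the two forms above is four times the mixed term; by the
      parallelogram law the sum of their numerical bounds is the right-hand side.\<close>
    moreover have "q * (l2norm (\<lambda>x. f x + g x))\<^sup>2 + q * (l2norm (\<lambda>x. f x - g x))\<^sup>2
        = 2 * q * ((l2norm f)\<^sup>2 + (l2norm g)\<^sup>2)"
      using f g by (simp add: l2norm_add_sq l2norm_diff_sq algebra_simps)
    ultimately show ?thesis
      using num[OF L2_add[OF f g]] num[OF L2_diff[OF f g]] by linarith
  qed
  have scaled: "4 * (l2norm (H f))\<^sup>2 / s \<le> 2 * q * ((l2norm f)\<^sup>2 + (l2norm (H f))\<^sup>2 / s\<^sup>2)"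
    if "s > 0" for s
    using polar[OF L2_cmult[OF H, of "complex_of_real (1 / s)"]] that
    unfolding L2_inner_scale_right l2norm_cmult
    by (simp add: L2_inner_self power_mult_distrib power_divide norm_divide)
  have "(l2norm (H f))\<^sup>2 \<le> (q * l2norm f)\<^sup>2"
  proof (cases "q = 0")
    case True
    with scaled[of 1] show ?thesis by simp
  next
    case False
    with q have "q > 0" by simp
    from scaled[OF this] \<open>q > 0\<close> show ?thesis
      by (simp add: field_simps power2_eq_square)
  qed
  then show ?thesis
    by (rule power2_le_imp_le) (simp add: q l2norm_nonneg)
qed

text \<open>The integral of the sum equals the sum of the integrals, which is finite, so the sum is
  finite almost everywhere. This is how norm estimates yield the pointwise convergence that
  \<open>Av_repr\<close> asks for.\<close>

lemma AE_summable_integrable: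
  fixes g :: "nat \<Rightarrow> 'a \<Rightarrow> real"
  assumes int: "\<And>n. integrable M (g n)" and nonneg: "\<And>n x. 0 \<le> g n x"
    and sm: "summable (\<lambda>n. LINT x|M. g n x)"
  shows "AE x in M. summable (\<lambda>n. g n x)"
proof -
  have [measurable]: "g n \<in> borel_measurable M" for n
    using int by auto
  have "(\<integral>\<^sup>+x. (\<Sum>n. ennreal (g n x)) \<partial>M) = (\<Sum>n. \<integral>\<^sup>+x. ennreal (g n x) \<partial>M)"
    by (rule nn_integral_suminf) measurable
  also have "\<dots> = (\<Sum>n. ennreal (LINT x|M. g n x))"
    using int nonneg by (simp add: nn_integral_eq_integral)
  also have "\<dots> = ennreal (\<Sum>n. LINT x|M. g n x)"
    using sm nonneg by (intro suminf_ennreal2) auto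
  also have "\<dots> \<noteq> \<infinity>"
    by simp
  finally have "AE x in M. (\<Sum>n. ennreal (g n x)) \<noteq> \<infinity>"
    by (intro nn_integral_PInf_AE) auto
  then show ?thesis
    by eventually_elim (auto intro: summable_suminf_not_top nonneg)
qed

text \<open>\<open>opnorm2\<close> is a bare supremum of reals, so its set must first be shown
  bounded; the rest is scaling \<open>f\<close> to norm 1. For \<open>f\<close> of norm 0 the
  constant \<open>K\<close> already forces \<open>S f\<close> to have norm 0.\<close>

lemma opnorm2_bound:
  assumes S: "bounded_op_L2 S" and f: "f \<in> L2"
  shows "l2norm (S f) \<le> opnorm2 S * l2norm f"
proof -
  from S obtain K where K: "\<And>f. f \<in> L2 \<Longrightarrow> l2norm (S f) \<le> K * l2norm f"
    unfolding bounded_op_L2_def by blast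
  have SL: "\<And>f. f \<in> L2 \<Longrightarrow> S f \<in> L2"
    using S unfolding bounded_op_L2_def by blast
  have hom: "l2norm (S (\<lambda>y. a * f y)) = cmod a * l2norm (S f)" for a
  proof -
    have "l2norm (S (\<lambda>y. a * f y)) = l2norm (\<lambda>x. a * S f x)"
      by (rule l2norm_cong_AE)
        (use S f SL L2_cmult[OF f] L2_cmult[OF SL[OF f]] in
          \<open>auto simp: bounded_op_L2_def L2_measurable\<close>)
    then show ?thesis by (simp add: l2norm_cmult)
  qed
  have bdd: "bdd_above {l2norm (S f) | f. f \<in> L2 \<and> l2norm f \<le> 1}"
  proof (rule bdd_aboveI)
    fix y assume "y \<in> {l2norm (S f) | f. f \<in> L2 \<and> l2norm f \<le> 1}"
    then obtain g where g: "y = l2norm (S g)" "g \<in> L2" "l2norm g \<le> 1" by auto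
    have "y \<le> K * l2norm g" using K g by simp
    also have "\<dots> \<le> \<bar>K\<bar> * l2norm g" by (intro mult_right_mono l2norm_nonneg) auto
    also have "\<dots> \<le> \<bar>K\<bar> * 1" using g by (intro mult_left_mono) auto
    finally show "y \<le> \<bar>K\<bar>" by simp
  qed
  show ?thesis
  proof (cases "l2norm f = 0")
    case True
    then show ?thesis using K[OF f] by simp
  next
    case False
    then have pos: "l2norm f > 0" using l2norm_nonneg[of f] by simp
    define g where "g = (\<lambda>y. complex_of_real (1 / l2norm f) * f y)"
    have "g \<in> L2" "l2norm g \<le> 1"
      unfolding g_def l2norm_cmult by (rule L2_cmult[OF f]) (use pos in \<open>simp add: norm_divide\<close>)
    then have "l2norm (S g) \<le> opnorm2 S"
      unfolding opnorm2_def by (intro cSup_upper bdd) auto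
    moreover have "l2norm (S g) = l2norm (S f) / l2norm f"
      unfolding g_def hom using pos by (simp add: norm_divide)
    ultimately show ?thesis using pos by (simp add: field_simps)
  qed
qed

section \<open>Finite sums of time-frequency shifts\<close>

lemma tfshift_0: "tfshift 0 f = f"
  by (simp add: tfshift_def fun_eq_iff)

lemma cis_mult_left: "cis a * (cis b * z) = cis (a + b) * z"
  by (simp add: cis_mult flip: mult.assoc)

text \<open>The translation of \<open>l\<close> acts on the character of \<open>k\<close>, and this
  leaves the phase; otherwise the shifts multiply like the additive group.\<close>

lemma tfshift_tfshift:
  "tfshift l (tfshift k f) x = cis (- (snd k \<bullet> fst l)) * tfshift (l + k) f x"
  by (simp add: tfshift_def cis_mult_left inner_diff_right inner_add_left diff_diff_eq add_diff_eq)

lemma tfshift_cmult: "tfshift l (\<lambda>y. a * f y) x = a * tfshift l f x"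
  by (simp add: tfshift_def)

lemma tfshift_add: "tfshift l (\<lambda>y. f y + g y) x = tfshift l f x + tfshift l g x"
  by (simp add: tfshift_def algebra_simps)

lemma tfshift_sum: "tfshift l (\<lambda>y. \<Sum>i\<in>I. f i y) x = (\<Sum>i\<in>I. tfshift l (f i) x)"
  by (simp add: tfshift_def sum_distrib_left)

lemma norm_tfshift: "cmod (tfshift l f x) = cmod (f (x - fst l))"
  by (simp add: tfshift_def norm_mult)

lemma tfshift_cong_AE:
  assumes "AE x in lebesgue. f x = g x"
  shows "AE x in lebesgue. tfshift l f x = tfshift l g x"
  using AE_lebesgue_translate[OF assms, of "- fst l"] by (auto simp: tfshift_def)

lemma
  assumes "f \<in> L2"
  shows L2_tfshift: "tfshift l f \<in> L2"
    and l2norm_tfshift: "l2norm (tfshift l f) = l2norm f"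
proof -
  note [measurable] = L2_measurable[OF assms]
  have "(\<lambda>x. f (x - fst l)) \<in> borel_measurable lebesgue"
    using borel_measurable_lebesgue_translate[of f "- fst l"] by simp
  moreover have "(\<lambda>x. cis (snd l \<bullet> x)) \<in> borel_measurable lebesgue"
    by (intro measurable_completion)
       (simp add: borel_measurable_continuous_onI continuous_intros cis_conv_exp)
  ultimately have "tfshift l f \<in> borel_measurable lebesgue"
    unfolding tfshift_def by (intro borel_measurable_times) auto
  moreover have "integrable lebesgue (\<lambda>x. (cmod (f (x - fst l)))\<^sup>2)"
    using integrable_lebesgue_translate[of "\<lambda>x. (cmod (f x))\<^sup>2" "- fst l"] L2_integrable[OF assms]
    by simp
  ultimately show "tfshift l f \<in> L2"
    by (simp add: L2_def norm_tfshift)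
  show "l2norm (tfshift l f) = l2norm f"
    using integral_lebesgue_translate[of "\<lambda>x. (cmod (f x))\<^sup>2" "- fst l"]
    by (simp add: l2norm_def norm_tfshift)
qed

lemma complex_inner_eq_Re: "a \<bullet> b = Re (a * cnj b)" for a b :: complex
  by (simp add: inner_complex_def)

lemma inner_cmult_left: "(a * b) \<bullet> c = b \<bullet> (cnj a * c)" for a b c :: complex
  by (simp add: inner_complex_def algebra_simps)

text \<open>A shift is unitary, so its adjoint is its inverse, which is the shift by
  \<open>- l\<close> up to a phase. The proof substitutes \<open>x - fst l\<close> for
  \<open>x\<close>.\<close>

lemma L2_inner_tfshift:
  assumes "f \<in> L2" "g \<in> L2"
  shows "L2_inner (tfshift l f) g = L2_inner f (\<lambda>x. cis (- (fst l \<bullet> snd l)) * tfshift (- l) g x)"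
proof -
  note [measurable] = assms[THEN L2_measurable]
  let ?h = "\<lambda>x. cis (- (fst l \<bullet> snd l)) * tfshift (- l) g x"
  have [measurable]: "?h \<in> borel_measurable lebesgue"
    using L2_measurable[OF L2_tfshift[OF assms(2)]] by measurable
  have "f (x - fst l) \<bullet> ?h (x - fst l) = tfshift l f x \<bullet> g x" for x
  proof -
    have "?h (x - fst l) = cnj (cis (snd l \<bullet> x)) * g x"
      by (simp add: tfshift_def cis_mult_left cis_cnj inner_diff_right inner_commute)
    then show ?thesis
      unfolding tfshift_def[of l f] inner_cmult_left by simp
  qed
  then have "L2_inner (tfshift l f) g = (LINT x|lebesgue. f (x + - fst l) \<bullet> ?h (x + - fst l))"
    by (simp add: L2_inner_def)
  also have "\<dots> = (LINT x|lebesgue. f x \<bullet> ?h x)"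
    by (rule integral_lebesgue_translate) measurable
  finally show ?thesis by (simp add: L2_inner_def)
qed

section \<open>Bounds, adjoints and products of finite sums of shifts\<close>

lemma tfsum_add: "tfsum L a (\<lambda>y. f y + g y) = (\<lambda>x. tfsum L a f x + tfsum L a g x)"
  by (simp add: tfsum_def tfshift_add algebra_simps sum.distrib fun_eq_iff)

lemma tfsum_cmult: "tfsum L a (\<lambda>y. z * f y) = (\<lambda>x. z * tfsum L a f x)"
  by (simp add: tfsum_def tfshift_cmult sum_distrib_left fun_eq_iff mult_ac)

lemma tfsum_diff: "tfsum L a (\<lambda>y. f y - g y) = (\<lambda>x. tfsum L a f x - tfsum L a g x)"
  using tfsum_add[of L a f "\<lambda>y. - 1 * g y"] unfolding tfsum_cmult by simp

lemma tfsum_coeff_cmult: "tfsum L (\<lambda>l. z * a l) f = (\<lambda>x. z * tfsum L a f x)"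
  by (simp add: tfsum_def sum_distrib_left fun_eq_iff mult_ac)

lemma tfsum_cong_AE:
  assumes "finite L" "AE x in lebesgue. f x = g x"
  shows "AE x in lebesgue. tfsum L a f x = tfsum L a g x"
proof -
  have "AE x in lebesgue. \<forall>l\<in>L. tfshift l f x = tfshift l g x"
    by (intro AE_finite_allI assms(1) tfshift_cong_AE[OF assms(2)])
  then show ?thesis
    by eventually_elim (simp add: tfsum_def)
qed

lemma L2_tfsum: "f \<in> L2 \<Longrightarrow> tfsum L a f \<in> L2"
  unfolding tfsum_def by (intro L2_sum L2_cmult L2_tfshift)

text \<open>Pointwise Cauchy-Schwarz over the \<open>card L\<close> summands, then integration,
  where every shift preserves the norm. The constant is crude; only boundedness is drawn from
  it.\<close>

lemma l2norm_tfsum_le: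
  assumes "finite L" "f \<in> L2"
  shows "l2norm (tfsum L a f) \<le> sqrt (card L * (\<Sum>l\<in>L. (cmod (a l))\<^sup>2)) * l2norm f"
proof -
  note shift = L2_tfshift[OF assms(2)]
  have pt: "(cmod (tfsum L a f x))\<^sup>2 \<le> card L * (\<Sum>l\<in>L. (cmod (a l))\<^sup>2 * (cmod (tfshift l f x))\<^sup>2)" for x
  proof -
    have "(cmod (tfsum L a f x))\<^sup>2 \<le> (\<Sum>l\<in>L. cmod (a l) * cmod (tfshift l f x))\<^sup>2"
      unfolding tfsum_def by (intro power_mono order.trans[OF norm_sum]) (auto simp: norm_mult)
    also have "\<dots> \<le> card L * (\<Sum>l\<in>L. (cmod (a l) * cmod (tfshift l f x))\<^sup>2)"
      using Cauchy_Schwarz_ineq_sum[of "\<lambda>_. 1" "\<lambda>l. cmod (a l) * cmod (tfshift l f x)" L] by simp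
    finally show ?thesis by (simp add: power_mult_distrib)
  qed
  have "(l2norm (tfsum L a f))\<^sup>2
      \<le> (LINT x|lebesgue. card L * (\<Sum>l\<in>L. (cmod (a l))\<^sup>2 * (cmod (tfshift l f x))\<^sup>2))"
    unfolding l2norm_sq using L2_integrable[OF L2_tfsum[OF assms(2)]] L2_integrable[OF shift] pt
    by (intro integral_mono) auto
  also have "\<dots> = card L * (\<Sum>l\<in>L. (cmod (a l))\<^sup>2) * (l2norm f)\<^sup>2"
    using L2_integrable[OF shift] l2norm_tfshift[OF assms(2)]
    by (simp add: sum_distrib_right flip: l2norm_sq)
  finally have "sqrt ((l2norm (tfsum L a f))\<^sup>2) \<le> sqrt (card L * (\<Sum>l\<in>L. (cmod (a l))\<^sup>2) * (l2norm f)\<^sup>2)"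
    by (rule real_sqrt_le_mono)
  then show ?thesis by (simp add: real_sqrt_mult l2norm_nonneg)
qed

lemma bounded_op_L2_tfsum: "finite L \<Longrightarrow> bounded_op_L2 (tfsum L a)"
  unfolding bounded_op_L2_def
  using l2norm_tfsum_le by (auto simp: L2_tfsum tfsum_add tfsum_cmult)

text \<open>The coefficients of the adjoint sum, which lives on the reflected set. The phase is that
  of \<open>L2_inner_tfshift\<close> and is the same at \<open>l\<close> and
  \<open>- l\<close>.\<close>

definition adjoint_coeff :: "('a::euclidean_space \<times> 'a \<Rightarrow> complex) \<Rightarrow> 'a \<times> 'a \<Rightarrow> complex" where
  "adjoint_coeff c l = cis (- (fst l \<bullet> snd l)) * cnj (c (- l))"

lemma L2_inner_tfsum:
  assumes "f \<in> L2" "g \<in> L2"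
  shows "L2_inner (tfsum L c f) g = L2_inner f (tfsum (uminus ` L) (adjoint_coeff c) g)"
proof -
  note shift = L2_tfshift[OF assms(1)] L2_tfshift[OF assms(2)]
  have "L2_inner (tfsum L c f) g = (\<Sum>l\<in>L. L2_inner (\<lambda>x. c l * tfshift l f x) g)"
    unfolding tfsum_def using assms by (intro L2_inner_sum_left L2_cmult shift) auto
  also have "\<dots> = (\<Sum>l\<in>L. L2_inner f (\<lambda>x. adjoint_coeff c (- l) * tfshift (- l) g x))"
  proof (rule sum.cong[OF refl])
    fix l
    have "L2_inner (\<lambda>x. c l * tfshift l f x) g = L2_inner (tfshift l f) (\<lambda>x. cnj (c l) * g x)"
      by (simp add: L2_inner_def inner_cmult_left)
    also have "\<dots> = L2_inner f (\<lambda>x. cis (- (fst l \<bullet> snd l)) * tfshift (- l) (\<lambda>x. cnj (c l) * g x) x)"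
      by (intro L2_inner_tfshift L2_cmult assms)
    finally show "L2_inner (\<lambda>x. c l * tfshift l f x) g
        = L2_inner f (\<lambda>x. adjoint_coeff c (- l) * tfshift (- l) g x)"
      by (simp add: tfshift_cmult adjoint_coeff_def mult.assoc)
  qed
  also have "\<dots> = L2_inner f (\<lambda>x. \<Sum>l\<in>L. adjoint_coeff c (- l) * tfshift (- l) g x)"
    using assms by (intro L2_inner_sum_right[symmetric] L2_cmult shift) auto
  also have "(\<lambda>x. \<Sum>l\<in>L. adjoint_coeff c (- l) * tfshift (- l) g x)
      = tfsum (uminus ` L) (adjoint_coeff c) g"
    by (simp add: tfsum_def sum.reindex fun_eq_iff)
  finally show ?thesis .
qed

text \<open>These are the coefficients of a product, with the phase of
  \<open>tfshift_tfshift\<close>. The finite supports are arguments because the coefficient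
  functions need not vanish outside them.\<close>

definition twisted_conv :: "('a::euclidean_space \<times> 'a) set \<Rightarrow> ('a \<times> 'a \<Rightarrow> complex) \<Rightarrow>
    ('a \<times> 'a) set \<Rightarrow> ('a \<times> 'a \<Rightarrow> complex) \<Rightarrow> 'a \<times> 'a \<Rightarrow> complex" where
  "twisted_conv K a L b n =
     (\<Sum>p\<in>{p \<in> K \<times> L. fst p + snd p = n}. a (fst p) * b (snd p) * cis (- (snd (snd p) \<bullet> fst (fst p))))"

lemma tfsum_tfsum:
  assumes "finite K" "finite L" "finite M" "\<And>k l. k \<in> K \<Longrightarrow> l \<in> L \<Longrightarrow> k + l \<in> M"
  shows "tfsum K a (tfsum L b f) = tfsum M (twisted_conv K a L b) f"
proof
  fix x
  let ?t = "\<lambda>p. a (fst p) * b (snd p) * cis (- (snd (snd p) \<bullet> fst (fst p))) * tfshift (fst p + snd p) f x"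
  have "tfsum K a (tfsum L b f) x = (\<Sum>k\<in>K. \<Sum>l\<in>L. ?t (k, l))"
    unfolding tfsum_def tfshift_sum tfshift_cmult tfshift_tfshift
    by (simp add: sum_distrib_left mult_ac)
  also have "\<dots> = sum ?t (K \<times> L)"
    by (simp add: sum.cartesian_product split_def)
  also have "\<dots> = (\<Sum>n\<in>M. sum ?t {p \<in> K \<times> L. fst p + snd p = n})"
    using assms by (intro sum.group[symmetric]) auto
  also have "\<dots> = tfsum M (twisted_conv K a L b) f x"
    unfolding tfsum_def twisted_conv_def sum_distrib_right by (intro sum.cong) auto
  finally show "tfsum K a (tfsum L b f) x = tfsum M (twisted_conv K a L b) f x" .
qed

text \<open>Up to a phase of modulus 1, each pair \<open>(k, l)\<close> contributes the product of
  its coefficients at \<open>k + l\<close>, where submultiplicativity splits the weight. This is the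
  algebra property of the weighted norm.\<close>

lemma weighted_norm_twisted_conv_le:
  assumes "finite K" "finite L" "finite M" "\<And>k l. k \<in> K \<Longrightarrow> l \<in> L \<Longrightarrow> k + l \<in> M"
    and v: "\<And>l. 0 \<le> v l" "submultiplicative v"
  shows "(\<Sum>n\<in>M. v n * cmod (twisted_conv K a L b n))
      \<le> (\<Sum>k\<in>K. v k * cmod (a k)) * (\<Sum>l\<in>L. v l * cmod (b l))"
proof -
  let ?t = "\<lambda>p. (v (fst p) * cmod (a (fst p))) * (v (snd p) * cmod (b (snd p)))"
  have "(\<Sum>n\<in>M. v n * cmod (twisted_conv K a L b n))
      \<le> (\<Sum>n\<in>M. sum ?t {p \<in> K \<times> L. fst p + snd p = n})"
  proof (rule sum_mono)
    fix n
    have "v n * cmod (twisted_conv K a L b n)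
        \<le> v n * (\<Sum>p\<in>{p \<in> K \<times> L. fst p + snd p = n}. cmod (a (fst p)) * cmod (b (snd p)))"
      unfolding twisted_conv_def
      by (intro mult_left_mono v order.trans[OF norm_sum]) (auto simp: norm_mult intro!: sum_mono)
    also have "\<dots> \<le> sum ?t {p \<in> K \<times> L. fst p + snd p = n}"
      unfolding sum_distrib_left
    proof (rule sum_mono)
      fix p assume "p \<in> {p \<in> K \<times> L. fst p + snd p = n}"
      then have "v n \<le> v (fst p) * v (snd p)"
        using v(2) by (auto simp: submultiplicative_def)
      then have "v n * (cmod (a (fst p)) * cmod (b (snd p)))
          \<le> v (fst p) * v (snd p) * (cmod (a (fst p)) * cmod (b (snd p)))"
        by (intro mult_right_mono) auto
      then show "v n * (cmod (a (fst p)) * cmod (b (snd p))) \<le> ?t p"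
        by (simp add: mult_ac)
    qed
    finally show "v n * cmod (twisted_conv K a L b n) \<le> sum ?t {p \<in> K \<times> L. fst p + snd p = n}" .
  qed
  also have "\<dots> = sum ?t (K \<times> L)"
    using assms by (intro sum.group) auto
  also have "\<dots> = (\<Sum>k\<in>K. v k * cmod (a k)) * (\<Sum>l\<in>L. v l * cmod (b l))"
    by (simp add: sum_product sum.cartesian_product split_def)
  finally show ?thesis .
qed

subsection \<open>Square summability of the coefficients\<close>

text \<open>The bound is independent of \<open>M\<close>; this is what makes the off-diagonal terms
  negligible in a mean over \<open>k < M\<close>.\<close>

lemma norm_geometric_sum_le:
  fixes z :: complex
  assumes "cmod z = 1" "z \<noteq> 1"
  shows "cmod (\<Sum>k<M. z ^ k) \<le> 2 / cmod (z - 1)"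
proof -
  have "cmod (\<Sum>k<M. z ^ k) = cmod (z ^ M - 1) / cmod (z - 1)"
    using assms by (simp add: geometric_sum norm_divide)
  also have "cmod (z ^ M - 1) \<le> 2"
    using norm_triangle_ineq4[of "z ^ M" 1] assms by (simp add: norm_power)
  finally show ?thesis by (simp add: divide_right_mono)
qed

text \<open>When the square is expanded, each diagonal pair gives \<open>M\<close> equal terms and
  each off-diagonal pair a geometric sum bounded independently of \<open>M\<close>. It matters that
  \<open>Q\<close> depends on the frequencies alone: in the application \<open>b\<close> varies with
  the point of integration.\<close>

lemma exponential_sum_mean_square_ge:
  fixes \<theta> :: "'i \<Rightarrow> real"
  assumes fin: "finite L" and inj: "inj_on (\<lambda>l. cis (\<theta> l)) L"
  obtains Q where "\<And>M b. (real M - Q) * (\<Sum>l\<in>L. (cmod (b l))\<^sup>2)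
      \<le> (\<Sum>k<M. (cmod (\<Sum>l\<in>L. b l * cis (real k * \<theta> l)))\<^sup>2)"
proof
  define z where "z p = cis (\<theta> (fst p) - \<theta> (snd p))" for p
  \<comment> \<open>Diagonal pairs have \<open>z p = 1\<close> and add nothing to \<open>Q\<close>,
    because division by 0 gives 0.\<close>
  define Q where "Q = (\<Sum>p\<in>L \<times> L. 2 / cmod (z p - 1))"
  fix M :: nat and b :: "'i \<Rightarrow> complex"
  define \<beta> where "\<beta> = (\<Sum>l\<in>L. (cmod (b l))\<^sup>2)"
  have \<beta>_ge: "cmod (b l) * cmod (b k) \<le> \<beta>" if "l \<in> L" "k \<in> L" for l k
  proof -
    have "(cmod (b l))\<^sup>2 \<le> \<beta>" "(cmod (b k))\<^sup>2 \<le> \<beta>"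
      unfolding \<beta>_def using fin that by (auto intro!: member_le_sum)
    then show ?thesis
      using sum_squares_bound[of "cmod (b l)" "cmod (b k)"] by simp
  qed
  have "\<beta> \<ge> 0" unfolding \<beta>_def by (intro sum_nonneg) auto
  let ?r = "\<lambda>p. Re (b (fst p) * cnj (b (snd p)) * (\<Sum>k<M. z p ^ k))"
  have "(\<Sum>k<M. (cmod (\<Sum>l\<in>L. b l * cis (real k * \<theta> l)))\<^sup>2)
      = (\<Sum>k<M. \<Sum>p\<in>L \<times> L. Re (b (fst p) * cnj (b (snd p)) * z p ^ k))"
  proof (rule sum.cong[OF refl])
    fix k
    let ?u = "\<lambda>l. b l * cis (real k * \<theta> l)"
    have "(cmod (sum ?u L))\<^sup>2 = (\<Sum>l\<in>L. \<Sum>j\<in>L. ?u l \<bullet> ?u j)"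
      unfolding power2_norm_eq_inner inner_sum_left inner_sum_right by (rule sum.swap)
    also have "\<dots> = (\<Sum>l\<in>L. \<Sum>j\<in>L. Re (b l * cnj (b j) * z (l, j) ^ k))"
    proof (intro sum.cong refl)
      fix l j
      have "z (l, j) ^ k = cis (real k * \<theta> l) * cnj (cis (real k * \<theta> j))"
        by (simp add: z_def Complex.DeMoivre cis_cnj cis_mult algebra_simps)
      then have "b l * cnj (b j) * z (l, j) ^ k = ?u l * cnj (?u j)"
        by (simp add: mult_ac)
      then show "?u l \<bullet> ?u j = Re (b l * cnj (b j) * z (l, j) ^ k)"
        unfolding complex_inner_eq_Re by (rule arg_cong[where f = Re, OF sym])
    qed
    finally show "(cmod (sum ?u L))\<^sup>2 = (\<Sum>p\<in>L \<times> L. Re (b (fst p) * cnj (b (snd p)) * z p ^ k))"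
      by (simp add: sum.cartesian_product split_def)
  qed
  also have "\<dots> = sum ?r (L \<times> L)"
    by (subst sum.swap) (simp add: sum_distrib_left)
  also have "\<dots> \<ge> (\<Sum>p\<in>L \<times> L. (if fst p = snd p then M * (cmod (b (fst p)))\<^sup>2 else 0)
      - 2 / cmod (z p - 1) * \<beta>)"
  proof (rule sum_mono)
    fix p assume p: "p \<in> L \<times> L"
    show "(if fst p = snd p then M * (cmod (b (fst p)))\<^sup>2 else 0) - 2 / cmod (z p - 1) * \<beta> \<le> ?r p"
    proof (cases "fst p = snd p")
      case True
      then have "z p = 1" by (simp add: z_def)
      with True show ?thesis
        by (simp add: complex_mult_cnj cmod_power2 mult.commute[of "real M"])
    next
      case False
      have "cis (\<theta> (fst p)) \<noteq> cis (\<theta> (snd p))"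
        using inj_onD[OF inj, of "fst p" "snd p"] p False by (auto simp: mem_Times_iff)
      then have "z p \<noteq> 1"
        by (simp add: z_def flip: cis_divide)
      have "- ?r p \<le> cmod (b (fst p) * cnj (b (snd p)) * (\<Sum>k<M. z p ^ k))"
        using abs_Re_le_cmod[of "b (fst p) * cnj (b (snd p)) * (\<Sum>k<M. z p ^ k)"] by linarith
      also have "\<dots> \<le> \<beta> * (2 / cmod (z p - 1))"
        unfolding norm_mult complex_mod_cnj using p \<open>\<beta> \<ge> 0\<close> \<open>z p \<noteq> 1\<close>
        by (intro mult_mono \<beta>_ge norm_geometric_sum_le) (auto simp: z_def)
      finally show ?thesis using False by (simp add: mult.commute)
    qed
  qed
  also have "(\<Sum>p\<in>L \<times> L. (if fst p = snd p then M * (cmod (b (fst p)))\<^sup>2 else 0)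
      - 2 / cmod (z p - 1) * \<beta>) = M * \<beta> - Q * \<beta>"
  proof -
    have "(\<Sum>p\<in>L \<times> L. if fst p = snd p then M * (cmod (b (fst p)))\<^sup>2 else 0)
        = (\<Sum>l\<in>L. \<Sum>j\<in>L. if l = j then M * (cmod (b l))\<^sup>2 else 0)"
      by (simp add: sum.cartesian_product split_def)
    also have "\<dots> = M * \<beta>"
      using fin by (simp add: \<beta>_def sum_distrib_left)
    finally show ?thesis
      by (simp add: sum_subtractf Q_def sum_distrib_right)
  qed
  finally show "(real M - Q) * (\<Sum>l\<in>L. (cmod (b l))\<^sup>2)
      \<le> (\<Sum>k<M. (cmod (\<Sum>l\<in>L. b l * cis (real k * \<theta> l)))\<^sup>2)"
    by (simp add: \<beta>_def algebra_simps)
qed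

text \<open>For two distinct points, the frequencies that fail to separate them fill countably many
  parallel hyperplanes. Finitely many pairs give a null set, so some \<open>w\<close> avoids them
  all.\<close>

lemma exists_separating_character:
  fixes L :: "'b::euclidean_space set"
  assumes "finite L"
  shows "\<exists>w. inj_on (\<lambda>l. cis (w \<bullet> l)) L"
proof -
  define N where "N = (\<Union>p\<in>{p \<in> L \<times> L. fst p \<noteq> snd p}. \<Union>n::int. {w. (fst p - snd p) \<bullet> w = 2 * pi * n})"
  have "negligible N"
    unfolding N_def using assms
    by (intro negligible_countable_Union)
       (auto intro!: negligible_countable_Union negligible_hyperplane intro: countable_finite)
  then obtain w where w: "w \<notin> N"
    using non_negligible_UNIV by (metis UNIV_eq_I)
  have "inj_on (\<lambda>l. cis (w \<bullet> l)) L"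
  proof (rule inj_onI, rule ccontr)
    fix l k assume lk: "l \<in> L" "k \<in> L" "cis (w \<bullet> l) = cis (w \<bullet> k)" "l \<noteq> k"
    then have "cis (w \<bullet> l - w \<bullet> k) = 1"
      by (simp flip: cis_divide)
    then have "cos (w \<bullet> l - w \<bullet> k) = 1"
      by (simp add: complex_eq_iff)
    then obtain n :: int where "w \<bullet> l - w \<bullet> k = 2 * pi * n"
      by (auto simp: cos_one_2pi_int mult_ac)
    then have "(l - k) \<bullet> w = 2 * pi * n"
      by (simp add: inner_commute[of _ w] inner_diff_right)
    then have "w \<in> N"
      unfolding N_def using lk by (intro UN_I[of "(l, k)"] UN_I[of n]) auto
    with w show False ..
  qed
  then show ?thesis by blast
qed

text \<open>Conjugation by time-frequency shifts multiplies the coefficients by characters and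
  preserves the operator norm; averaging over these characters kills the cross terms.\<close>
lemma tfsum_coeff_l2_le:
  fixes L :: "('a::euclidean_space \<times> 'a) set"
  assumes fin: "finite L" and K: "\<And>f. f \<in> L2 \<Longrightarrow> l2norm (tfsum L a f) \<le> K * l2norm f"
  shows "(\<Sum>l\<in>L. (cmod (a l))\<^sup>2) \<le> K\<^sup>2"
proof -
  obtain w where w: "inj_on (\<lambda>l. cis (w \<bullet> l)) L"
    using exists_separating_character[OF fin] by blast
  obtain Q where Q: "\<And>M b. (real M - Q) * (\<Sum>l\<in>L. (cmod (b l))\<^sup>2)
      \<le> (\<Sum>k<M. (cmod (\<Sum>l\<in>L. b l * cis (real k * (w \<bullet> l))))\<^sup>2)"
    using exponential_sum_mean_square_ge[OF fin w] by blast
  obtain f :: "'a \<Rightarrow> complex" where f: "f \<in> L2" "l2norm f = 1"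
    using L2_nontrivial by blast
  define \<alpha> where "\<alpha> = (\<Sum>l\<in>L. (cmod (a l))\<^sup>2)"
  define F where "F k = tfsum L (\<lambda>l. a l * cis (real k * (w \<bullet> l))) f" for k :: nat
  have F: "l2norm (F k) \<le> K" for k
  proof -
    \<comment> \<open>\<open>u\<close> is \<open>k\<close> times \<open>w\<close> rotated
      symplectically: \<open>tfshift l\<close> and \<open>tfshift u\<close> commute up to the phase
      \<open>cis (snd l \<bullet> fst u - snd u \<bullet> fst l)\<close>, which for this choice is
      \<open>cis (real k * (w \<bullet> l))\<close>.\<close>
    define u where "u = real k *\<^sub>R (snd w, - fst w)"
    have "tfsum L a (tfshift u f) = tfshift u (F k)"
    proof
      fix x
      have "tfshift l (tfshift u f) x = cis (real k * (w \<bullet> l)) * tfshift u (tfshift l f) x" for l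
        unfolding tfshift_tfshift
        by (simp add: u_def add.commute[of l] cis_mult_left inner_prod_def inner_commute right_diff_distrib
            distrib_left)
      then show "tfsum L a (tfshift u f) x = tfshift u (F k) x"
        unfolding F_def tfsum_def tfshift_sum tfshift_cmult by (simp add: mult_ac)
    qed
    then have "l2norm (F k) = l2norm (tfsum L a (tfshift u f))"
      using l2norm_tfshift[OF L2_tfsum[OF f(1)]] unfolding F_def by simp
    also have "\<dots> \<le> K"
      using K[OF L2_tfshift[OF f(1)]] l2norm_tfshift[OF f(1)] f(2) by simp
    finally show ?thesis .
  qed
  have FL: "F k \<in> L2" for k
    unfolding F_def by (rule L2_tfsum[OF f(1)])
  \<comment> \<open>The mean-square bound is applied at every point \<open>x\<close> to the numbers
    \<open>a l * tfshift l f x\<close> and then integrated; as \<open>M\<close> grows,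
    \<open>Q\<close> becomes negligible.\<close>
  have main: "(real M - Q) * \<alpha> \<le> M * K\<^sup>2" for M
  proof -
    have "(real M - Q) * \<alpha> = (LINT x|lebesgue. (real M - Q) * (\<Sum>l\<in>L. (cmod (a l * tfshift l f x))\<^sup>2))"
      using L2_integrable[OF L2_tfshift[OF f(1)]] l2norm_tfshift[OF f(1)] f(2)
      by (simp add: \<alpha>_def norm_mult power_mult_distrib flip: l2norm_sq)
    also have "\<dots> \<le> (LINT x|lebesgue. (\<Sum>k<M. (cmod (F k x))\<^sup>2))"
    proof (rule integral_mono)
      fix x
      show "(real M - Q) * (\<Sum>l\<in>L. (cmod (a l * tfshift l f x))\<^sup>2) \<le> (\<Sum>k<M. (cmod (F k x))\<^sup>2)"
        using Q[of M "\<lambda>l. a l * tfshift l f x"] by (simp add: F_def tfsum_def mult_ac)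
    qed (use L2_integrable[OF FL] L2_integrable[OF L2_tfshift[OF f(1)]] in
        \<open>auto simp: norm_mult power_mult_distrib\<close>)
    also have "\<dots> = (\<Sum>k<M. (l2norm (F k))\<^sup>2)"
      using L2_integrable[OF FL] by (simp add: l2norm_sq)
    also have "\<dots> \<le> (\<Sum>k<M. K\<^sup>2)"
      by (intro sum_mono power_mono F l2norm_nonneg)
    finally show ?thesis by simp
  qed
  have "\<alpha> \<le> K\<^sup>2"
  proof (rule ccontr)
    assume "\<not> \<alpha> \<le> K\<^sup>2"
    then obtain M :: nat where "Q * \<alpha> < M * (\<alpha> - K\<^sup>2)"
      using reals_Archimedean3[of "\<alpha> - K\<^sup>2"] by auto
    with main[of M] show False by (simp add: algebra_simps)
  qed
  then show ?thesis by (simp add: \<alpha>_def)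
qed

section \<open>Supports of powers\<close>

text \<open>A multiset of \<open>n\<close> elements of \<open>L\<close> is encoded by its
  multiplicities \<open>k\<close>, so that counting becomes stars and bars.\<close>

definition nfold_sums :: "'b::real_vector set \<Rightarrow> nat \<Rightarrow> 'b set" where
  "nfold_sums L n = {\<Sum>l\<in>L. real (k l) *\<^sub>R l | k. sum k L = n}"

lemma
  assumes "finite L" "L \<noteq> {}"
  shows finite_nfold_sums: "finite (nfold_sums L n)"
    and card_nfold_sums_le: "card (nfold_sums L n) \<le> (n + card L - 1) choose n"
proof -
  define W where "W = {w :: nat list. length w = card L \<and> sum_list w = n}"
  obtain xs where xs: "set xs = L" "distinct xs"
    using finite_distinct_list[OF assms(1)] by blast
  then have len: "length xs = card L"
    by (simp add: distinct_card[symmetric])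
  define \<phi> where "\<phi> w = sum_list (map2 (\<lambda>j x. real j *\<^sub>R x) w xs)" for w
  have W: "card W = (n + card L - 1) choose n"
    unfolding W_def by (rule card_length_sum_list)
  have "card L > 0" using assms by (simp add: card_gt_0_iff)
  \<comment> \<open>An infinite set has cardinality 0, so a positive cardinality proves
    \<open>W\<close> finite.\<close>
  then have "card W > 0" unfolding W by (simp add: zero_less_binomial_iff)
  then have finW: "finite W" by (rule card_ge_0_finite)
  have "nfold_sums L n \<subseteq> \<phi> ` W"
  proof
    fix p assume "p \<in> nfold_sums L n"
    then obtain k where k: "p = (\<Sum>l\<in>L. real (k l) *\<^sub>R l)" "sum k L = n"
      by (auto simp: nfold_sums_def)
    have "map2 (\<lambda>j x. real j *\<^sub>R x) (map k ys) ys = map (\<lambda>x. real (k x) *\<^sub>R x) ys" for ys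
      by (induction ys) auto
    then have "p = \<phi> (map k xs)"
      using xs k by (simp add: \<phi>_def sum_list_distinct_conv_sum_set)
    moreover have "map k xs \<in> W"
      using xs k len by (simp add: W_def sum_list_distinct_conv_sum_set)
    ultimately show "p \<in> \<phi> ` W" by blast
  qed
  then show "finite (nfold_sums L n)" "card (nfold_sums L n) \<le> (n + card L - 1) choose n"
    unfolding W[symmetric]
    by (rule finite_subset[OF _ finite_imageI[OF finW]], rule surj_card_le[OF finW])
qed

lemma nfold_sums_add:
  assumes "p \<in> nfold_sums L n" "q \<in> nfold_sums L m"
  shows "p + q \<in> nfold_sums L (n + m)"
proof -
  obtain k j where "p = (\<Sum>l\<in>L. real (k l) *\<^sub>R l)" "sum k L = n"
    "q = (\<Sum>l\<in>L. real (j l) *\<^sub>R l)" "sum j L = m"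
    using assms by (auto simp: nfold_sums_def)
  then have "p + q = (\<Sum>l\<in>L. real (k l + j l) *\<^sub>R l)" "(\<Sum>l\<in>L. k l + j l) = n + m"
    by (simp_all add: scaleR_left_distrib sum.distrib)
  then show ?thesis
    unfolding nfold_sums_def mem_Collect_eq by (intro exI[of _ "\<lambda>l. k l + j l"] conjI)
qed

lemma zero_in_nfold_sums: "0 \<in> nfold_sums L 0"
  unfolding nfold_sums_def by (auto intro!: exI[of _ "\<lambda>_. 0"])

lemma in_nfold_sums_1:
  assumes "finite L" "l \<in> L"
  shows "l \<in> nfold_sums L 1"
proof -
  let ?k = "\<lambda>j. if j = l then 1 else 0 :: nat"
  have "(\<Sum>j\<in>L. real (?k j) *\<^sub>R j) = l"
    using assms by (simp add: if_distrib[of real] if_distrib[of "\<lambda>c. c *\<^sub>R _"] cong: if_cong)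
  moreover have "sum ?k L = 1" using assms by simp
  ultimately show ?thesis unfolding nfold_sums_def by force
qed

lemma norm_nfold_sums_le:
  fixes L :: "'b::real_normed_vector set"
  assumes "p \<in> nfold_sums L n" "\<And>l. l \<in> L \<Longrightarrow> norm l \<le> R"
  shows "norm p \<le> n * R"
proof -
  obtain k where k: "p = (\<Sum>l\<in>L. real (k l) *\<^sub>R l)" "sum k L = n"
    using assms by (auto simp: nfold_sums_def)
  have "norm p \<le> (\<Sum>l\<in>L. real (k l) * R)"
    unfolding k(1) by (rule order.trans[OF norm_sum]) (auto intro!: sum_mono mult_left_mono assms)
  also have "\<dots> = n * R"
    using k(2) by (simp flip: sum_distrib_right of_nat_sum)
  finally show ?thesis .
qed

text \<open>The \<open>n\<close>-fold sums of differences from \<open>L\<close> are written as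
  differences of two \<open>n\<close>-fold sums: the count is then at most the square of a binomial
  coefficient, and Cauchy-Schwarz later takes its root.\<close>

definition nfold_diffs :: "'b::real_vector set \<Rightarrow> nat \<Rightarrow> 'b set" where
  "nfold_diffs L n = (\<lambda>(p, q). p - q) ` (nfold_sums L n \<times> nfold_sums L n)"

lemma
  assumes "finite L" "L \<noteq> {}"
  shows finite_nfold_diffs: "finite (nfold_diffs L n)"
    and card_nfold_diffs_le: "card (nfold_diffs L n) \<le> ((n + card L - 1) choose n)\<^sup>2"
proof -
  show "finite (nfold_diffs L n)"
    unfolding nfold_diffs_def using finite_nfold_sums[OF assms] by simp
  have "card (nfold_diffs L n) \<le> card (nfold_sums L n \<times> nfold_sums L n)"
    unfolding nfold_diffs_def using finite_nfold_sums[OF assms] by (intro card_image_le) simp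
  also have "\<dots> \<le> ((n + card L - 1) choose n)\<^sup>2"
    unfolding card_cartesian_product power2_eq_square
    by (intro mult_mono card_nfold_sums_le assms) auto
  finally show "card (nfold_diffs L n) \<le> ((n + card L - 1) choose n)\<^sup>2" .
qed

lemma nfold_diffs_add:
  assumes "p \<in> nfold_diffs L n" "q \<in> nfold_diffs L m"
  shows "p + q \<in> nfold_diffs L (n + m)"
proof -
  obtain a b c d where "p = a - b" "q = c - d" "a \<in> nfold_sums L n" "b \<in> nfold_sums L n"
    "c \<in> nfold_sums L m" "d \<in> nfold_sums L m"
    using assms by (auto simp: nfold_diffs_def)
  then have "p + q = (a + c) - (b + d)" "a + c \<in> nfold_sums L (n + m)" "b + d \<in> nfold_sums L (n + m)"
    by (auto intro: nfold_sums_add)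
  then show ?thesis
    unfolding nfold_diffs_def by (intro image_eqI[of _ _ "(a + c, b + d)"]) auto
qed

lemma zero_in_nfold_diffs: "0 \<in> nfold_diffs L 0"
  unfolding nfold_diffs_def by (rule image_eqI[of _ _ "(0, 0)"]) (auto simp: zero_in_nfold_sums)

lemma diff_in_nfold_diffs_1: "finite L \<Longrightarrow> l \<in> L \<Longrightarrow> k \<in> L \<Longrightarrow> l - k \<in> nfold_diffs L 1"
  unfolding nfold_diffs_def
  by (rule image_eqI[of _ _ "(l, k)"]) (auto intro: in_nfold_sums_1[simplified])

lemma norm_nfold_diffs_le:
  fixes L :: "'b::real_normed_vector set"
  assumes "p \<in> nfold_diffs L n" "\<And>l. l \<in> L \<Longrightarrow> norm l \<le> R"
  shows "norm p \<le> 2 * n * R"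
proof -
  obtain a b where "p = a - b" "a \<in> nfold_sums L n" "b \<in> nfold_sums L n"
    using assms by (auto simp: nfold_diffs_def)
  moreover from this have "norm a \<le> n * R" "norm b \<le> n * R"
    using norm_nfold_sums_le assms(2) by blast+
  ultimately show ?thesis
    using norm_triangle_ineq4[of a b] by simp
qed

section \<open>The binomial series\<close>

text \<open>This is the generalised binomial series with exponent \<open>- (K + 1)\<close> at
  \<open>- q\<close>; the signs of the coefficient and of \<open>(- q) ^ n\<close> cancel.\<close>

lemma negative_binomial_sums:
  fixes q :: real
  assumes "0 \<le> q" "q < 1"
  shows "(\<lambda>n. real ((n + K) choose n) * q ^ n) sums (1 / (1 - q)) ^ (K + 1)"
proof -
  have "(\<lambda>n. ((- real (K + 1)) gchoose n) * (- q) ^ n) sums (1 + - q) powr (- real (K + 1))"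
    by (rule gen_binomial_real) (use assms in simp)
  moreover have "((- real (K + 1)) gchoose n) * (- q) ^ n = real ((n + K) choose n) * q ^ n" for n
  proof -
    have "((- real (K + 1)) gchoose n) = (- 1) ^ n * (real (n + K) gchoose n)"
      unfolding gbinomial_minus by (simp add: algebra_simps)
    also have "(real (n + K) gchoose n) = real ((n + K) choose n)"
      by (rule binomial_gbinomial[symmetric])
    finally have "((- real (K + 1)) gchoose n) * (- q) ^ n
        = real ((n + K) choose n) * ((- 1) * (- q)) ^ n"
      by (simp only: power_mult_distrib mult_ac)
    then show ?thesis by simp
  qed
  moreover have "(1 + - q) powr (- real (K + 1)) = (1 / (1 - q)) ^ (K + 1)"
    using assms by (simp only: powr_minus powr_realpow) (simp add: power_one_over inverse_eq_divide)
  ultimately show ?thesis by simp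
qed

text \<open>Each factor \<open>1 + n\<close> is at most \<open>n + ?K + 1\<close>, and absorption
  turns that factor into \<open>?K + 1\<close> times the next binomial coefficient. A polynomial
  weight thus only raises the binomial parameter, and the series can still be summed in closed form.
  The product of the factors from \<open>J + 1\<close> to \<open>J + m\<close> is rounded up to a
  factorial.\<close>

lemma power_times_binomial_le: "(1 + n) ^ m * ((n + J) choose n) \<le> fact (J + m) * ((n + J + m) choose n)"
  for n :: nat
proof (induction m)
  case 0
  then show ?case by (simp add: fact_ge_1)
next
  case (Suc m)
  let ?K = "J + m"
  have "(1 + n) ^ Suc m * ((n + J) choose n) \<le> (1 + n) * (fact ?K * ((n + ?K) choose n))"
    using Suc by (simp add: add.assoc mult.assoc del: mult_Suc)
  also have "\<dots> \<le> fact ?K * ((n + ?K + 1) * ((n + ?K) choose n))"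
    by (simp only: mult.left_commute[of "1 + n"]) (intro mult_left_mono mult_right_mono; simp)
  also have "(n + ?K + 1) * ((n + ?K) choose n) = (?K + 1) * ((n + ?K + 1) choose n)"
    using binomial_absorb_comp[of "n + ?K + 1" n] by simp
  finally show ?case by (simp add: algebra_simps)
qed

section \<open>Series of finite sums\<close>

text \<open>Summable row norms make the double family absolutely summable, so rows and columns may
  be interchanged. Each row vanishes off \<open>E n\<close>, so its infinite sum is a finite
  one.\<close>

lemma
  fixes a :: "nat \<Rightarrow> 'i \<Rightarrow> 'b::banach"
  assumes fin: "\<And>n. finite (E n)" and zero: "\<And>n l. l \<notin> E n \<Longrightarrow> a n l = 0"
    and sm: "summable (\<lambda>n. \<Sum>l\<in>E n. norm (a n l))"
  shows column_sums_norm_summable: "(\<lambda>l. norm (\<Sum>\<^sub>\<infinity>n. a n l)) summable_on UNIV"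
    and infsum_norm_column_sums_le:
      "(\<Sum>\<^sub>\<infinity>l. norm (\<Sum>\<^sub>\<infinity>n. a n l)) \<le> (\<Sum>n. \<Sum>l\<in>E n. norm (a n l))"
    and row_sums_sums: "(\<lambda>n. \<Sum>l\<in>E n. a n l) sums (\<Sum>\<^sub>\<infinity>l. \<Sum>\<^sub>\<infinity>n. a n l)"
proof -
  have row: "((\<lambda>l. a n l) has_sum (\<Sum>l\<in>E n. a n l)) UNIV" for n
    by (rule has_sum_finite_neutralI[OF fin]) (auto simp: zero)
  have rown: "((\<lambda>l. norm (a n l)) has_sum (\<Sum>l\<in>E n. norm (a n l))) UNIV" for n
    by (rule has_sum_finite_neutralI[OF fin]) (auto simp: zero)
  have sm': "(\<lambda>n. \<Sum>l\<in>E n. norm (a n l)) summable_on UNIV"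
    using sm by (subst summable_on_UNIV_nonneg_real_iff) (auto intro: sum_nonneg)
  have abs: "(\<lambda>p. norm ((\<lambda>(n, l). a n l) p)) summable_on UNIV \<times> UNIV"
    by (rule summable_on_SigmaI[OF _ sm']) (auto simp: rown)
  then have swap: "(\<lambda>p. norm ((\<lambda>(l, n). a n l) p)) summable_on UNIV \<times> UNIV"
    by (subst (asm) summable_on_swap) (simp add: split_def)
  then have col: "(\<lambda>n. norm (a n l)) summable_on UNIV"
    and cols: "(\<lambda>l. norm (\<Sum>\<^sub>\<infinity>n. norm (a n l))) summable_on UNIV" for l
    using Infinite_Sum.abs_summable_on_Sigma_iff[where f = "\<lambda>(l, n). a n l" and A = UNIV and B = "\<lambda>_. UNIV"]
    by (auto simp del: UNIV_Times_UNIV)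
  have cols': "(\<lambda>l. \<Sum>\<^sub>\<infinity>n. norm (a n l)) summable_on UNIV"
    by (rule abs_summable_summable[OF cols])
  have le: "norm (\<Sum>\<^sub>\<infinity>n. a n l) \<le> (\<Sum>\<^sub>\<infinity>n. norm (a n l))" for l
    using norm_infsum_bound[OF col] .
  show 1: "(\<lambda>l. norm (\<Sum>\<^sub>\<infinity>n. a n l)) summable_on UNIV"
    by (rule summable_on_comparison_test[OF cols' le]) auto
  have "(\<Sum>\<^sub>\<infinity>l. norm (\<Sum>\<^sub>\<infinity>n. a n l)) \<le> (\<Sum>\<^sub>\<infinity>l. \<Sum>\<^sub>\<infinity>n. norm (a n l))"
    by (rule infsum_mono[OF 1 cols' le])
  also have "\<dots> = (\<Sum>\<^sub>\<infinity>n. \<Sum>\<^sub>\<infinity>l. norm (a n l))"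
    by (rule infsum_swap_banach) (use swap in \<open>simp add: split_def\<close>)
  also have "\<dots> = (\<Sum>\<^sub>\<infinity>n. \<Sum>l\<in>E n. norm (a n l))"
    by (intro infsum_cong infsumI rown)
  also have "\<dots> = (\<Sum>n. \<Sum>l\<in>E n. norm (a n l))"
    using has_sum_imp_sums[OF has_sum_infsum[OF sm']] by (simp add: sums_iff)
  finally show "(\<Sum>\<^sub>\<infinity>l. norm (\<Sum>\<^sub>\<infinity>n. a n l)) \<le> (\<Sum>n. \<Sum>l\<in>E n. norm (a n l))" .
  have "(\<lambda>n. \<Sum>l\<in>E n. a n l) summable_on UNIV"
    by (rule norm_summable_imp_summable_on)
       (rule summable_norm_comparison_test[OF _ sm], use norm_sum in blast)
  then have "(\<lambda>n. \<Sum>l\<in>E n. a n l) sums (\<Sum>\<^sub>\<infinity>n. \<Sum>l\<in>E n. a n l)"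
    using has_sum_imp_sums has_sum_infsum by blast
  also have "(\<Sum>\<^sub>\<infinity>n. \<Sum>l\<in>E n. a n l) = (\<Sum>\<^sub>\<infinity>n. \<Sum>\<^sub>\<infinity>l. a n l)"
    by (intro infsum_cong infsumI[symmetric] row)
  also have "\<dots> = (\<Sum>\<^sub>\<infinity>l. \<Sum>\<^sub>\<infinity>n. a n l)"
    by (rule infsum_swap_banach) (use abs abs_summable_summable in blast)
  finally show "(\<lambda>n. \<Sum>l\<in>E n. a n l) sums (\<Sum>\<^sub>\<infinity>l. \<Sum>\<^sub>\<infinity>n. a n l)" .
qed

text \<open>\<open>d\<close> collects, for each shift, its coefficients across all terms of the
  series. The weighted claims are the preceding interchange applied to \<open>v l * e n l\<close>;
  the pointwise one needs an almost-everywhere argument, as \<open>f\<close> need not be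
  bounded.\<close>

lemma
  fixes e :: "nat \<Rightarrow> 'a::euclidean_space \<times> 'a \<Rightarrow> complex"
  assumes fin: "\<And>n. finite (E n)" and zero: "\<And>n l. l \<notin> E n \<Longrightarrow> e n l = 0"
    and v: "\<And>l. 1 \<le> v l"
    and b: "\<And>n. (\<Sum>l\<in>E n. v l * cmod (e n l)) \<le> b n" "summable b"
  defines "d \<equiv> \<lambda>l. \<Sum>\<^sub>\<infinity>n. e n l"
  shows Av_series_summable: "(\<lambda>l. v l * cmod (d l)) summable_on UNIV"
    and Av_series_norm_le: "Av_norm v d \<le> suminf b"
    and Av_series_sums: "f \<in> L2 \<Longrightarrow> AE x in lebesgue.
      (\<lambda>l. d l * tfshift l f x) summable_on UNIV \<and>
      (\<lambda>n. tfsum (E n) (e n) f x) sums (\<Sum>\<^sub>\<infinity>l. d l * tfshift l f x)"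
proof -
  have v0: "0 \<le> v l" for l using v[of l] by linarith
  have nrm: "norm (of_real (v l) * z) = v l * cmod z" for l z
    by (simp add: norm_mult v0)
  have d: "norm (\<Sum>\<^sub>\<infinity>n. of_real (v l) * e n l) = v l * cmod (d l)" for l
    unfolding infsum_cmult_right' nrm d_def ..
  have bpos: "0 \<le> (\<Sum>l\<in>E n. v l * cmod (e n l))" for n
    by (intro sum_nonneg) (simp add: v0)
  have sm: "summable (\<lambda>n. \<Sum>l\<in>E n. norm (of_real (v l) * e n l))"
    unfolding nrm by (rule summable_comparison_test_ev[OF _ b(2)])
      (auto intro!: always_eventually simp: bpos b)
  note col = column_sums_norm_summable[of E "\<lambda>n l. of_real (v l) * e n l", OF fin _ sm]
    infsum_norm_column_sums_le[of E "\<lambda>n l. of_real (v l) * e n l", OF fin _ sm]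
  show "(\<lambda>l. v l * cmod (d l)) summable_on UNIV"
    using col(1) zero unfolding d by simp
  have "Av_norm v d \<le> (\<Sum>n. \<Sum>l\<in>E n. v l * cmod (e n l))"
    using col(2) zero unfolding d nrm Av_norm_def by simp
  also have "\<dots> \<le> suminf b"
    using sm b unfolding nrm by (intro suminf_le)
  finally show "Av_norm v d \<le> suminf b" .

  have le1: "(\<Sum>l\<in>E n. cmod (e n l)) \<le> b n" for n
  proof -
    have "(\<Sum>l\<in>E n. cmod (e n l)) \<le> (\<Sum>l\<in>E n. v l * cmod (e n l))"
      using mult_right_mono[OF v norm_ge_zero] by (intro sum_mono) simp
    with b(1)[of n] show ?thesis by linarith
  qed
  show "AE x in lebesgue. (\<lambda>l. d l * tfshift l f x) summable_on UNIV \<and>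
      (\<lambda>n. tfsum (E n) (e n) f x) sums (\<Sum>\<^sub>\<infinity>l. d l * tfshift l f x)" if f: "f \<in> L2"
  proof -
    \<comment> \<open>The integral of \<open>g n\<close> is at most \<open>b n\<close> times the
      squared norm of \<open>f\<close>, so the \<open>g n x\<close> are summable in \<open>n\<close>
      for almost every \<open>x\<close>.\<close>
    define g where "g n x = (\<Sum>l\<in>E n. cmod (e n l) * (cmod (tfshift l f x))\<^sup>2)" for n x
    have intg: "integrable lebesgue (g n)" for n
      unfolding g_def using L2_integrable[OF L2_tfshift[OF f]] by auto
    have g0: "0 \<le> g n x" for n x unfolding g_def by (intro sum_nonneg) simp
    have "(LINT x|lebesgue. g n x) = (\<Sum>l\<in>E n. cmod (e n l)) * (l2norm f)\<^sup>2" for n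
      unfolding g_def using L2_integrable[OF L2_tfshift[OF f]] l2norm_tfshift[OF f]
      by (simp add: sum_distrib_right flip: l2norm_sq)
    then have "(LINT x|lebesgue. g n x) \<le> b n * (l2norm f)\<^sup>2" for n
      using le1 by (simp add: mult_right_mono)
    moreover have "0 \<le> (LINT x|lebesgue. g n x)" for n
      using g0 by simp
    ultimately have "summable (\<lambda>n. LINT x|lebesgue. g n x)"
      by (intro summable_comparison_test_ev[OF _ summable_mult2[OF b(2)]])
         (auto intro!: always_eventually)
    then have "AE x in lebesgue. summable (\<lambda>n. g n x)"
      by (rule AE_summable_integrable[OF intg g0])
    then show ?thesis
    proof eventually_elim
      case (elim x)
      have pt: "(\<Sum>l\<in>E n. cmod (e n l * tfshift l f x)) \<le> b n + g n x" for n
      proof -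
        \<comment> \<open>Only the squares of the shifted functions are known to be integrable, so
          moduli are traded for squares; the extra 1 is absorbed by \<open>b n\<close>.\<close>
        have "t \<le> 1 + t\<^sup>2" for t :: real
          using zero_le_power2[of "t - 1 / 2"] by (simp add: power2_eq_square algebra_simps)
        then have "(\<Sum>l\<in>E n. cmod (e n l * tfshift l f x))
            \<le> (\<Sum>l\<in>E n. cmod (e n l) * (1 + (cmod (tfshift l f x))\<^sup>2))"
          unfolding norm_mult by (intro sum_mono mult_left_mono) auto
        also have "\<dots> = (\<Sum>l\<in>E n. cmod (e n l)) + g n x"
          by (simp add: g_def distrib_left sum.distrib)
        finally show ?thesis using le1[of n] by linarith
      qed
      have "summable (\<lambda>n. \<Sum>l\<in>E n. cmod (e n l * tfshift l f x))"
        by (rule summable_comparison_test_ev[OF _ summable_add[OF b(2) elim]])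
          (use pt in \<open>auto intro!: always_eventually simp: sum_nonneg\<close>)
      from column_sums_norm_summable[of E "\<lambda>n l. e n l * tfshift l f x", OF fin _ this]
        row_sums_sums[of E "\<lambda>n l. e n l * tfshift l f x", OF fin _ this]
      show ?case
        using zero abs_summable_summable unfolding infsum_cmult_left' d_def tfsum_def by simp
    qed
  qed
qed

section \<open>The Neumann series of the normal equation\<close>

lemma tfsum_delta: "finite L \<Longrightarrow> 0 \<in> L \<Longrightarrow> tfsum L (\<lambda>l. if l = 0 then 1 else 0) f = f"
  by (simp add: tfsum_def fun_eq_iff tfshift_0 if_distrib[of "\<lambda>c. c * _"] cong: if_cong)

lemma tfsum_coeff_diff: "tfsum L (\<lambda>l. a l - b l) f = (\<lambda>x. tfsum L a f x - tfsum L b f x)"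
  by (simp add: tfsum_def fun_eq_iff left_diff_distrib sum_subtractf)

lemma twisted_conv_eq_0:
  assumes "l \<notin> (\<lambda>(p, q). p + q) ` (K \<times> L)"
  shows "twisted_conv K a L b l = 0"
proof -
  have "{p \<in> K \<times> L. fst p + snd p = l} = {}"
    using assms by (force simp: image_iff)
  then show ?thesis unfolding twisted_conv_def by (simp only: sum.empty)
qed

text \<open>The factor \<open>2 / (A + B)\<close> is the centring choice:
  \<open>1 - 2 * A / (A + B)\<close> and \<open>1 - 2 * B / (A + B)\<close> are \<open>q\<close> and
  \<open>- q\<close> for \<open>q = (B - A) / (A + B)\<close>. Hence the numerical radius is at most
  \<open>q\<close>, and symmetry turns this into a norm bound.\<close>

lemma normal_equation_contraction:
  fixes L :: "('a::euclidean_space \<times> 'a) set"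
  assumes fin: "finite L" and ne: "L \<noteq> {}" and AB: "0 < A" "A \<le> B"
    and lower: "\<And>f. f \<in> L2 \<Longrightarrow> A * (l2norm f)\<^sup>2 \<le> (l2norm (tfsum L c f))\<^sup>2"
    and upper: "\<And>f. f \<in> L2 \<Longrightarrow> (l2norm (tfsum L c f))\<^sup>2 \<le> B * (l2norm f)\<^sup>2"
  obtains h where
    "\<And>f. tfsum (nfold_diffs L 1) h f = (\<lambda>x. f x -
       complex_of_real (2 / (A + B)) * tfsum (uminus ` L) (adjoint_coeff c) (tfsum L c f) x)"
    "\<And>f. f \<in> L2 \<Longrightarrow> l2norm (tfsum (nfold_diffs L 1) h f) \<le> (B - A) / (A + B) * l2norm f"
proof
  let ?D = "nfold_diffs L 1" and ?T = "tfsum L c" and ?T' = "tfsum (uminus ` L) (adjoint_coeff c)"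
  let ?\<kappa> = "2 / (A + B)"
  define h where "h l = (if l = 0 then 1 else 0) -
    complex_of_real ?\<kappa> * twisted_conv (uminus ` L) (adjoint_coeff c) L c l" for l
  obtain l0 where "l0 \<in> L" using ne by blast
  then have D0: "0 \<in> ?D"
    using diff_in_nfold_diffs_1[OF fin, of l0 l0] by simp
  have conv: "tfsum ?D (twisted_conv (uminus ` L) (adjoint_coeff c) L c) f = ?T' (?T f)" for f
  proof (rule tfsum_tfsum[symmetric])
    fix k l assume "k \<in> uminus ` L" "l \<in> L"
    then obtain j where "k + l = l - j" "j \<in> L" by auto
    then show "k + l \<in> ?D"
      using diff_in_nfold_diffs_1[OF fin \<open>l \<in> L\<close>] by simp
  qed (use fin ne finite_nfold_diffs in auto)
  show H: "tfsum ?D h f = (\<lambda>x. f x - complex_of_real ?\<kappa> * ?T' (?T f) x)" for f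
    unfolding h_def tfsum_coeff_diff tfsum_coeff_cmult conv
      tfsum_delta[OF finite_nfold_diffs[OF fin ne] D0] ..
  have TL: "?T f \<in> L2" "?T' (?T f) \<in> L2" if "f \<in> L2" for f
    using that by (auto intro!: L2_tfsum)
  \<comment> \<open>Moving the adjoint to the other side makes the form visibly symmetric, and on
    the diagonal it involves only the norms of \<open>f\<close> and \<open>?T f\<close>.\<close>
  have form: "L2_inner (tfsum ?D h f) g = L2_inner f g - ?\<kappa> * L2_inner (?T f) (?T g)"
    if "f \<in> L2" "g \<in> L2" for f g
  proof -
    have "L2_inner (tfsum ?D h f) g = L2_inner f g - ?\<kappa> * L2_inner (?T' (?T f)) g"
      unfolding H using that TL by (simp only: L2_inner_diff_left L2_inner_scale_left L2_cmult)
    also have "L2_inner (?T' (?T f)) g = L2_inner g (?T' (?T f))"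
      by (rule L2_inner_commute)
    also have "\<dots> = L2_inner (?T g) (?T f)"
      using that TL by (intro L2_inner_tfsum[symmetric])
    finally show ?thesis by (simp only: L2_inner_commute[of "?T g"])
  qed
  fix f :: "'a \<Rightarrow> complex" assume f: "f \<in> L2"
  show "l2norm (tfsum ?D h f) \<le> (B - A) / (A + B) * l2norm f"
  proof (rule symmetric_L2_norm_le[OF f])
    fix f g :: "'a \<Rightarrow> complex" assume "f \<in> L2" "g \<in> L2"
    then show "L2_inner (tfsum ?D h f) g = L2_inner f (tfsum ?D h g)"
      by (simp only: form L2_inner_commute[of f "tfsum ?D h g"])
        (simp only: L2_inner_commute[of g f] L2_inner_commute[of "?T g" "?T f"])
  next
    fix f :: "'a \<Rightarrow> complex" assume f: "f \<in> L2"
    have "L2_inner (tfsum ?D h f) f = (l2norm f)\<^sup>2 - ?\<kappa> * (l2norm (?T f))\<^sup>2"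
      by (simp only: form[OF f f] L2_inner_self)
    moreover have "?\<kappa> * (A * (l2norm f)\<^sup>2) \<le> ?\<kappa> * (l2norm (?T f))\<^sup>2"
      "?\<kappa> * (l2norm (?T f))\<^sup>2 \<le> ?\<kappa> * (B * (l2norm f)\<^sup>2)"
      using AB f by (intro mult_left_mono lower upper; simp)+
    moreover have "(l2norm f)\<^sup>2 - ?\<kappa> * (A * (l2norm f)\<^sup>2) = (B - A) / (A + B) * (l2norm f)\<^sup>2"
      "(l2norm f)\<^sup>2 - ?\<kappa> * (B * (l2norm f)\<^sup>2) = - ((B - A) / (A + B) * (l2norm f)\<^sup>2)"
      using AB by (simp_all add: field_simps)
    ultimately show "\<bar>L2_inner (tfsum ?D h f) f\<bar> \<le> (B - A) / (A + B) * (l2norm f)\<^sup>2"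
      by linarith
  qed (use AB in \<open>auto simp: L2_tfsum tfsum_add tfsum_cmult\<close>)
qed

text \<open>The coefficients of the powers of the contraction. The new factor enters on the right,
  so that it acts first on the argument; the telescoping sum later uses this order.\<close>

primrec twisted_power :: "('a::euclidean_space \<times> 'a) set \<Rightarrow> ('a \<times> 'a \<Rightarrow> complex) \<Rightarrow>
    nat \<Rightarrow> 'a \<times> 'a \<Rightarrow> complex" where
  "twisted_power L h 0 = (\<lambda>l. if l = 0 then 1 else 0)"
| "twisted_power L h (Suc n) = twisted_conv (nfold_diffs L n) (twisted_power L h n) (nfold_diffs L 1) h"

lemma tfsum_twisted_power_0:
  assumes "finite L" "L \<noteq> {}"
  shows "tfsum (nfold_diffs L 0) (twisted_power L h 0) f = f"
  unfolding twisted_power.simps by (rule tfsum_delta[OF finite_nfold_diffs[OF assms] zero_in_nfold_diffs])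

lemma tfsum_twisted_power_Suc:
  assumes "finite L" "L \<noteq> {}"
  shows "tfsum (nfold_diffs L (Suc n)) (twisted_power L h (Suc n)) f
    = tfsum (nfold_diffs L n) (twisted_power L h n) (tfsum (nfold_diffs L 1) h f)"
  unfolding twisted_power.simps
  by (rule tfsum_tfsum[symmetric]) (use assms nfold_diffs_add[of _ L n _ 1] in \<open>auto intro: finite_nfold_diffs\<close>)

lemma l2norm_twisted_power_le:
  assumes "finite L" "L \<noteq> {}" "0 \<le> q" "f \<in> L2"
    and "\<And>f. f \<in> L2 \<Longrightarrow> l2norm (tfsum (nfold_diffs L 1) h f) \<le> q * l2norm f"
  shows "l2norm (tfsum (nfold_diffs L n) (twisted_power L h n) f) \<le> q ^ n * l2norm f"
  using assms(4)
proof (induction n arbitrary: f)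
  case 0
  then show ?case unfolding tfsum_twisted_power_0[OF assms(1,2)] by simp
next
  case (Suc n)
  have "l2norm (tfsum (nfold_diffs L n) (twisted_power L h n) (tfsum (nfold_diffs L 1) h f))
      \<le> q ^ n * l2norm (tfsum (nfold_diffs L 1) h f)"
    by (rule Suc.IH[OF L2_tfsum[OF Suc.prems]])
  also have "\<dots> \<le> q ^ n * (q * l2norm f)"
    using assms(3) by (intro mult_left_mono assms(5) Suc.prems) auto
  finally show ?case
    unfolding tfsum_twisted_power_Suc[OF assms(1,2)] by (simp add: mult_ac)
qed

text \<open>Cauchy-Schwarz turns the bound on the square sum of the coefficients into a bound on
  their absolute sum; the number of coefficients is the square of a binomial coefficient.\<close>
lemma weighted_norm_twisted_power_le:
  fixes L :: "('a::euclidean_space \<times> 'a) set"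
  assumes fin: "finite L" and ne: "L \<noteq> {}" and q: "0 \<le> q" and C: "0 \<le> C"
    and contr: "\<And>f. f \<in> L2 \<Longrightarrow> l2norm (tfsum (nfold_diffs L 1) h f) \<le> q * l2norm f"
    and v: "\<And>l. v l \<le> C * (1 + norm l) ^ m"
    and R: "\<And>l. l \<in> L \<Longrightarrow> norm l \<le> R"
  shows "(\<Sum>l\<in>nfold_diffs L n. v l * cmod (twisted_power L h n l))
    \<le> C * max 1 (2 * R) ^ m * fact (card L - 1 + m) * real ((n + (card L - 1 + m)) choose n) * q ^ n"
proof -
  let ?D = "nfold_diffs L n" and ?h = "twisted_power L h n" and ?\<rho> = "max 1 (2 * R)"
  let ?b = "(n + (card L - 1)) choose n"
  have "card L > 0" using fin ne by (simp add: card_gt_0_iff)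
  then have card: "card ?D \<le> ?b\<^sup>2"
    using card_nfold_diffs_le[OF fin ne, of n] by simp
  have vle: "v l \<le> C * (?\<rho> ^ m * real ((1 + n) ^ m))" if "l \<in> ?D" for l
  proof -
    \<comment> \<open>Both 1 and \<open>2 * R\<close> are at most \<open>?\<rho>\<close>, so
      \<open>1 + n * (2 * R)\<close> is at most \<open>?\<rho> * (1 + n)\<close>.\<close>
    have "1 + norm l \<le> 1 + n * (2 * R)"
      using norm_nfold_diffs_le[OF that R] by (simp add: mult_ac)
    also have "\<dots> \<le> ?\<rho> + n * ?\<rho>"
      by (intro add_mono mult_left_mono) auto
    finally have "(1 + norm l) ^ m \<le> (?\<rho> * real (1 + n)) ^ m"
      by (intro power_mono) (auto simp: algebra_simps)
    then show ?thesis
      using v[of l] mult_left_mono[OF _ C] by (fastforce simp: power_mult_distrib)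
  qed
  have l2: "(\<Sum>l\<in>?D. (cmod (?h l))\<^sup>2) \<le> (q ^ n)\<^sup>2"
    by (rule tfsum_coeff_l2_le[OF finite_nfold_diffs[OF fin ne]])
       (rule l2norm_twisted_power_le[OF fin ne q _ contr])
  have "(\<Sum>l\<in>?D. cmod (?h l))\<^sup>2 \<le> card ?D * (\<Sum>l\<in>?D. (cmod (?h l))\<^sup>2)"
    using Cauchy_Schwarz_ineq_sum[of "\<lambda>_. 1" "\<lambda>l. cmod (?h l)" ?D] by simp
  also have "\<dots> \<le> real (?b\<^sup>2) * (q ^ n)\<^sup>2"
    by (intro mult_mono l2 of_nat_mono card sum_nonneg) auto
  also have "\<dots> = (?b * q ^ n)\<^sup>2"
    by (simp add: power_mult_distrib)
  finally have abs: "(\<Sum>l\<in>?D. cmod (?h l)) \<le> ?b * q ^ n"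
    by (rule power2_le_imp_le) (use q in simp)
  have "(\<Sum>l\<in>?D. v l * cmod (?h l)) \<le> (\<Sum>l\<in>?D. C * (?\<rho> ^ m * real ((1 + n) ^ m)) * cmod (?h l))"
    by (intro sum_mono mult_right_mono vle) auto
  also have "\<dots> = C * (?\<rho> ^ m * real ((1 + n) ^ m)) * (\<Sum>l\<in>?D. cmod (?h l))"
    by (simp only: sum_distrib_left)
  also have "\<dots> \<le> C * (?\<rho> ^ m * real ((1 + n) ^ m)) * (?b * q ^ n)"
    using C by (intro mult_left_mono abs) auto
  also have "\<dots> = C * ?\<rho> ^ m * real ((1 + n) ^ m * ?b) * q ^ n"
    by simp
  also have "\<dots> \<le> C * ?\<rho> ^ m * real (fact (card L - 1 + m) * ((n + (card L - 1 + m)) choose n)) * q ^ n"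
    using C q power_times_binomial_le[of n m "card L - 1"]
    by (intro mult_left_mono mult_right_mono of_nat_mono) (auto simp: add.assoc)
  finally show ?thesis by (simp add: mult_ac)
qed

section \<open>The Neumann series represents the inverse\<close>

lemma weight_ge_1: "weight v \<Longrightarrow> 1 \<le> v x"
proof -
  assume "weight v"
  then have "v 0 = 1" "v (0 *\<^sub>R x) \<le> v (1 *\<^sub>R x)"
    unfolding weight_def by (blast, metis zero_le_one order_refl)
  then show ?thesis by simp
qed

theorem theorem3:
  fixes Lam :: "('a::euclidean_space \<times> 'a) set"
    and c :: "'a \<times> 'a \<Rightarrow> complex"
    and S :: "('a \<Rightarrow> complex) \<Rightarrow> ('a \<Rightarrow> complex)"
    and v :: "'a \<times> 'a \<Rightarrow> real"
    and C :: real and m :: nat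
  assumes fin: "finite Lam"
    and inv: "inverse_op_L2 S (tfsum Lam c)"
    and wt: "weight v" and sub: "submultiplicative v"
    and Cpos: "C > 0"
    and rad: "\<forall>r\<ge>0. radial_max v r (C * (1 + r) ^ m)"
  shows "\<exists>d. Av_repr v d S \<and>
     (let N = card Lam; R0 = Max (norm ` Lam); rho = max 1 (2 * R0);
          A = (opnorm2 S) powi (-2); B = (opnorm2 (tfsum Lam c))\<^sup>2;
          normT = (\<Sum>lam\<in>Lam. v lam * cmod (c lam))
      in Av_norm v d \<le> C * rho ^ m * normT / A * fact (m + N) * ((A + B) / (2 * A)) ^ (m + N))"
proof -
  let ?T = "tfsum Lam c" and ?T' = "tfsum (uminus ` Lam) (adjoint_coeff c)"
  define A where "A = (opnorm2 S) powi (-2)"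
  define B where "B = (opnorm2 ?T)\<^sup>2"
  define \<rho> where "\<rho> = max 1 (2 * Max (norm ` Lam))"
  define normT where "normT = (\<Sum>lam\<in>Lam. v lam * cmod (c lam))"
  define N where "N = card Lam"
  have S: "bounded_op_L2 S" and ST: "\<And>f. f \<in> L2 \<Longrightarrow> AE x in lebesgue. S (?T f) x = f x"
    and TS: "\<And>f. f \<in> L2 \<Longrightarrow> AE x in lebesgue. ?T (S f) x = f x"
    using inv unfolding inverse_op_L2_def by auto
  have SL: "S f \<in> L2" if "f \<in> L2" for f
    using S that unfolding bounded_op_L2_def by blast
  note Tbound = opnorm2_bound[OF bounded_op_L2_tfsum[OF fin], of _ c]
  have f_le: "l2norm f \<le> opnorm2 S * l2norm (?T f)" if f: "f \<in> L2" for f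
  proof -
    have "l2norm f = l2norm (S (?T f))"
      by (intro l2norm_cong_AE L2_measurable SL L2_tfsum f) (use ST[OF f] in auto)
    also have "\<dots> \<le> opnorm2 S * l2norm (?T f)"
      by (intro opnorm2_bound S L2_tfsum f)
    finally show ?thesis .
  qed
  obtain f1 :: "'a \<Rightarrow> complex" where f1: "f1 \<in> L2" "l2norm f1 = 1"
    using L2_nontrivial by blast
  \<comment> \<open>A nonpositive value would contradict \<open>l2norm f1 = 1\<close>. Positivity
    makes \<open>A\<close> a genuine reciprocal.\<close>
  have Spos: "opnorm2 S > 0"
    using f_le[OF f1(1)] f1(2) l2norm_nonneg[of "?T f1"]
    by (metis less_eq_real_def linorder_not_less mult_nonpos_nonneg not_one_le_zero order.trans)
  then have A_eq: "A = 1 / (opnorm2 S)\<^sup>2"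
    by (simp add: A_def power_int_minus inverse_eq_divide)
  have Apos: "A > 0" using Spos by (simp add: A_eq)
  have lower: "A * (l2norm f)\<^sup>2 \<le> (l2norm (?T f))\<^sup>2" if "f \<in> L2" for f
  proof -
    have "(l2norm f)\<^sup>2 \<le> (opnorm2 S * l2norm (?T f))\<^sup>2"
      by (intro power_mono f_le that l2norm_nonneg)
    then show ?thesis using Spos by (simp add: A_eq field_simps)
  qed
  have upper: "(l2norm (?T f))\<^sup>2 \<le> B * (l2norm f)\<^sup>2" if "f \<in> L2" for f
    using power_mono[OF Tbound[OF that] l2norm_nonneg, of 2] by (simp add: B_def power_mult_distrib)
  have AB: "A \<le> B" using lower[OF f1(1)] upper[OF f1(1)] f1(2) by simp
  have ne: "Lam \<noteq> {}"
  proof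
    assume "Lam = {}"
    then have "l2norm (?T f1) = 0" by (simp add: tfsum_def l2norm_def)
    with f_le[OF f1(1)] f1(2) show False by simp
  qed
  define \<kappa> where "\<kappa> = 2 / (A + B)"
  define q where "q = (B - A) / (A + B)"
  have q: "0 \<le> q" "q < 1" using Apos AB by (auto simp: q_def field_simps)
  \<comment> \<open>The factor \<open>1 / A\<close> of the final bound comes from here, by
    \<open>A \<le> B\<close>.\<close>
  have \<kappa>: "0 < \<kappa>" "\<kappa> \<le> 1 / A" using Apos AB by (auto simp: \<kappa>_def field_simps)
  obtain h where h: "\<And>f. tfsum (nfold_diffs Lam 1) h f
      = (\<lambda>x. f x - complex_of_real \<kappa> * ?T' (?T f) x)"
    and contr: "\<And>f. f \<in> L2 \<Longrightarrow> l2norm (tfsum (nfold_diffs Lam 1) h f) \<le> q * l2norm f"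
    using normal_equation_contraction[OF fin ne Apos AB lower upper] unfolding \<kappa>_def q_def by blast
  let ?D = "nfold_diffs Lam" and ?h = "twisted_power Lam h"
  define E where "E n = (\<lambda>(p, q). p + q) ` (?D n \<times> uminus ` Lam)" for n
  \<comment> \<open>\<open>e n\<close> holds the coefficients of the \<open>n\<close>-th Neumann
    term: \<open>\<kappa>\<close> times the \<open>n\<close>-th power of the contraction times the
    adjoint. \<open>b n\<close> will bound its weighted norm.\<close>
  define e where "e n l = complex_of_real \<kappa> * twisted_conv (?D n) (?h n) (uminus ` Lam) (adjoint_coeff c) l"
    for n l
  define b where "b n = \<kappa> * normT * C * \<rho> ^ m * fact (N - 1 + m) * (real ((n + (N - 1 + m)) choose n) * q ^ n)"
    for n
  have v1: "1 \<le> v l" for l by (rule weight_ge_1[OF wt])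
  have v0: "0 \<le> v l" for l using v1[of l] by linarith
  have finD: "finite (?D n)" for n by (rule finite_nfold_diffs[OF fin ne])
  have finE: "finite (E n)" for n unfolding E_def using finD fin by auto
  have E0: "e n l = 0" if "l \<notin> E n" for n l
    using twisted_conv_eq_0[OF that[unfolded E_def]] unfolding e_def by simp
  have inE: "k + l \<in> E n" if "k \<in> ?D n" "l \<in> uminus ` Lam" for k l n
    unfolding E_def using that by (intro image_eqI[of _ _ "(k, l)"]) auto
  have e: "tfsum (E n) (e n) f = (\<lambda>x. complex_of_real \<kappa> * tfsum (?D n) (?h n) (?T' f) x)" for n f
  proof -
    have "tfsum (?D n) (?h n) (?T' f)
        = tfsum (E n) (twisted_conv (?D n) (?h n) (uminus ` Lam) (adjoint_coeff c)) f"
      by (rule tfsum_tfsum[OF finD _ finE inE]) (use fin in auto)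
    then show ?thesis unfolding e_def tfsum_coeff_cmult by simp
  qed
  have normT': "(\<Sum>l\<in>uminus ` Lam. v l * cmod (adjoint_coeff c l)) = normT"
  proof -
    have "v (- l) = v l" for l using wt unfolding weight_def by blast
    then show ?thesis
      by (simp add: normT_def sum.reindex adjoint_coeff_def norm_mult)
  qed
  have normT0: "0 \<le> normT" unfolding normT_def by (intro sum_nonneg) (simp add: v0)
  have eb: "(\<Sum>l\<in>E n. v l * cmod (e n l)) \<le> b n" for n
  proof -
    have "(\<Sum>l\<in>E n. v l * cmod (e n l))
        = \<kappa> * (\<Sum>l\<in>E n. v l * cmod (twisted_conv (?D n) (?h n) (uminus ` Lam) (adjoint_coeff c) l))"
      using \<kappa> by (simp add: e_def norm_mult sum_distrib_left mult.left_commute)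
    also have "\<dots> \<le> \<kappa> * ((\<Sum>l\<in>?D n. v l * cmod (?h n l)) * normT)"
      unfolding normT'[symmetric] using \<kappa> fin
      by (intro mult_left_mono weighted_norm_twisted_conv_le finD finE inE v0 sub) auto
    also have "\<dots> \<le> \<kappa> * ((C * \<rho> ^ m * fact (N - 1 + m) * real ((n + (N - 1 + m)) choose n) * q ^ n) * normT)"
      unfolding \<rho>_def N_def
    proof (intro mult_left_mono mult_right_mono weighted_norm_twisted_power_le[OF fin ne q(1) _ contr])
      show "v l \<le> C * (1 + norm l) ^ m" for l
        using rad[rule_format, OF norm_ge_zero, of l] unfolding radial_max_def by blast
    qed (use Cpos \<kappa> normT0 fin in auto)
    finally show ?thesis by (simp add: b_def mult_ac)
  qed
  have "1 / (1 - q) = (A + B) / (2 * A)"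
    using Apos AB by (simp add: q_def field_simps)
  then have "(\<lambda>n. real ((n + (N - 1 + m)) choose n) * q ^ n) sums ((A + B) / (2 * A)) ^ (N - 1 + m + 1)"
    using negative_binomial_sums[OF q, of "N - 1 + m"] by simp
  \<comment> \<open>The series has binomial parameter \<open>N - 1 + m\<close>, hence an exponent
    one higher. As \<open>N\<close> is positive, the truncated subtraction is exact.\<close>
  moreover have N1: "N - 1 + m + 1 = m + N"
    using fin ne by (simp add: N_def card_gt_0_iff Suc_leI)
  ultimately have bsums: "b sums (\<kappa> * normT * C * \<rho> ^ m * fact (N - 1 + m) * ((A + B) / (2 * A)) ^ (m + N))"
    unfolding b_def by (intro sums_mult) (simp only:)
  have bsm: "summable b" using bsums by (rule sums_summable)
  define d where "d l = (\<Sum>\<^sub>\<infinity>n. e n l)" for l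
  note series = Av_series_summable[of E e v b, OF finE _ v1 eb bsm, folded d_def]
    Av_series_norm_le[of E e v b, OF finE _ v1 eb bsm, folded d_def]
    Av_series_sums[of E e v b, OF finE _ v1 eb bsm, folded d_def]
  have "Av_repr v d S"
    unfolding Av_repr_def
  proof (intro conjI ballI)
    show "(\<lambda>l. v l * cmod (d l)) summable_on UNIV"
      by (rule series(1)) (rule E0)
    fix f :: "'a \<Rightarrow> complex" assume f: "f \<in> L2"
    \<comment> \<open>\<open>P n\<close> is the \<open>n\<close>-th power of the contraction applied
      to \<open>S f\<close>. Since \<open>f\<close> is \<open>?T (S f)\<close> almost everywhere,
      the \<open>n\<close>-th Neumann term is \<open>P n - P (Suc n)\<close>, and the series
      telescopes to \<open>S f\<close> once \<open>P n\<close> tends to 0.\<close>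
    define P where "P n = tfsum (?D n) (?h n) (S f)" for n
    have same: "AE x in lebesgue. \<forall>n. tfsum (E n) (e n) (?T (S f)) x = tfsum (E n) (e n) f x"
      unfolding AE_all_countable by (intro allI tfsum_cong_AE finE TS f)
    have tele: "tfsum (E n) (e n) (?T (S f)) x = P n x - P (Suc n) x" for n x
    proof -
      have "P (Suc n) = tfsum (?D n) (?h n) (\<lambda>x. S f x - complex_of_real \<kappa> * ?T' (?T (S f)) x)"
        unfolding P_def tfsum_twisted_power_Suc[OF fin ne] h ..
      then show ?thesis
        unfolding e tfsum_diff tfsum_cmult by (simp add: P_def)
    qed
    \<comment> \<open>Convergence of \<open>P n\<close> to 0 in norm alone would not give
      convergence at points. Geometric decay makes the squares summable at almost every
      \<open>x\<close>, which does.\<close>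
    have sq: "AE x in lebesgue. summable (\<lambda>n. (cmod (P n x))\<^sup>2)"
    proof (rule AE_summable_integrable)
      show "integrable lebesgue (\<lambda>x. (cmod (P n x))\<^sup>2)" for n
        unfolding P_def by (intro L2_integrable L2_tfsum SL f)
      have le: "(l2norm (P n))\<^sup>2 \<le> (q\<^sup>2) ^ n * (l2norm (S f))\<^sup>2" for n
      proof -
        have "l2norm (P n) \<le> q ^ n * l2norm (S f)"
          unfolding P_def by (intro l2norm_twisted_power_le[OF fin ne q(1) SL[OF f] contr])
        from power_mono[OF this l2norm_nonneg, of 2] show ?thesis
          by (simp add: power_mult_distrib flip: power_mult) (simp add: mult.commute)
      qed
      have "summable (\<lambda>n. (q\<^sup>2) ^ n * (l2norm (S f))\<^sup>2)"
        using q by (intro summable_mult2 summable_geometric) (simp add: power_less_one_iff)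
      then show "summable (\<lambda>n. LINT x|lebesgue. (cmod (P n x))\<^sup>2)"
        unfolding l2norm_sq[symmetric]
        by (rule summable_comparison_test[rotated]) (use le in simp)
    qed auto
    have sums: "AE x in lebesgue. (\<lambda>l. d l * tfshift l f x) summable_on UNIV \<and>
        (\<lambda>n. tfsum (E n) (e n) f x) sums (\<Sum>\<^sub>\<infinity>l. d l * tfshift l f x)"
      by (rule series(3)[OF _ f]) (rule E0)
    show "AE x in lebesgue. (\<lambda>l. d l * tfshift l f x) summable_on UNIV \<and>
        S f x = (\<Sum>\<^sub>\<infinity>l. d l * tfshift l f x)"
      using same sq sums
    proof eventually_elim
      case (elim x)
      have "(\<lambda>n. (cmod (P n x))\<^sup>2) \<longlonglongrightarrow> 0"
        by (rule summable_LIMSEQ_zero[OF elim(2)])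
      then have "(\<lambda>n. sqrt ((cmod (P n x))\<^sup>2)) \<longlonglongrightarrow> sqrt 0"
        by (rule tendsto_real_sqrt)
      then have "(\<lambda>n. P n x) \<longlonglongrightarrow> 0"
        by (simp add: tendsto_norm_zero_iff)
      then have "(\<lambda>n. P n x - P (Suc n) x) sums (P 0 x - 0)"
        by (rule telescope_sums')
      moreover have "P 0 x = S f x"
        unfolding P_def tfsum_twisted_power_0[OF fin ne] ..
      ultimately have "(\<lambda>n. tfsum (E n) (e n) f x) sums S f x"
        using elim(1) tele by simp
      then show ?case
        using elim(3) sums_unique2 by blast
    qed
  qed
  moreover have "Av_norm v d \<le> C * \<rho> ^ m * normT / A * fact (m + N) * ((A + B) / (2 * A)) ^ (m + N)"
  proof -
    have "Av_norm v d \<le> suminf b"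
      by (rule series(2)) (rule E0)
    also have "\<dots> = (C * \<rho> ^ m * normT * ((A + B) / (2 * A)) ^ (m + N)) * (\<kappa> * fact (N - 1 + m))"
      using bsums by (simp add: sums_iff mult_ac)
    \<comment> \<open>\<open>\<kappa>\<close> is rounded up to \<open>1 / A\<close>, and the
      factorial of \<open>N - 1 + m\<close> to that of \<open>m + N\<close>.\<close>
    also have "\<dots> \<le> (C * \<rho> ^ m * normT * ((A + B) / (2 * A)) ^ (m + N)) * (1 / A * fact (m + N))"
      using Cpos normT0 Apos AB \<kappa> N1
      by (intro mult_left_mono mult_mono fact_mono mult_nonneg_nonneg zero_le_power)
         (auto simp: \<rho>_def)
    finally show ?thesis by (simp add: mult_ac)
  qed
  ultimately show ?thesis
    unfolding Let_def A_def[symmetric] B_def[symmetric] \<rho>_def[symmetric] normT_def[symmetric]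
      N_def[symmetric] by blast
qed

end
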